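(* The counting Orthogonal Vectors problem $\#\mathsf{OV}$ on $n+n$ vectors in $\{0,1\}^d$ can be solved by a deterministic algorithm in time $\tilde O(n\cdot 1.26^d)$.
   Context: In $\#\mathsf{OV}$ one is given vectors $u_1,\dots,u_n,v_1,\dots,v_n\in\{0,1\}^d$ and must output the number of pairs $(i,j)\in[n]\times[n]$ with $\langle u_i,v_j\rangle=0$, the inner product being over $\mathbb{Z}$. $\tilde O$ hides factors polynomial in $d$ and $\log n$. *)

theory Defs
  imports Complex_Main "HOL-Library.Log_Nat"
begin

section \<open>Random access machines with logarithmic cost\<close>

text \<open>
  The machine model is the textbook random access machine over the integers under the
  logarithmic cost criterion (Cook--Reckhow; Aho--Hopcroft--Ullman), with structured control
  flow in place of jumps.  A program is a fixed finite text and so names only finitely many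
  registers; the memory is unbounded and is accessible by indirect addressing only.  Every
  step is charged the bit lengths of the integers it handles, addresses included, so no power
  is gained from large integers.  For running times polynomial in \<open>n\<close> and \<open>2 ^ d\<close>, a word RAM with
  \<open>O(d + log n)\<close>-bit words agrees up to
  factors polynomial in \<open>d\<close> and \<open>log n\<close>.
\<close>

type_synonym reg = nat

datatype arith = ADD | SUB | MUL | DIV

datatype comparison = LESS | EQ

datatype com =
    Const reg int
  | Arith arith reg reg reg
  | Load reg reg
  | Store reg reg
  | Seq com com
  | Cond comparison reg reg com com
  | While comparison reg reg com

text \<open>
  A state consists of the registers and the memory.  Memory cells are indexed by all integers,
  so that every register content is a legal address.
\<close>

type_synonym state = "(reg \<Rightarrow> int) \<times> (int \<Rightarrow> int)"

fun arith_val :: "arith \<Rightarrow> int \<Rightarrow> int \<Rightarrow> int" where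
  "arith_val ADD a b = a + b"
| "arith_val SUB a b = a - b"
| "arith_val MUL a b = a * b"
| "arith_val DIV a b = a div b"

fun compare_val :: "comparison \<Rightarrow> int \<Rightarrow> int \<Rightarrow> bool" where
  "compare_val LESS a b = (a < b)"
| "compare_val EQ a b = (a = b)"

text \<open>Length of the binary representation, including one bit for the sign.\<close>

definition bits :: "int \<Rightarrow> nat" where
  "bits z = 1 + floorlog 2 (nat \<bar>z\<bar>)"

text \<open>\<open>exec c s t s'\<close>: started in state \<open>s\<close>, program \<open>c\<close> halts in state \<open>s'\<close> after time \<open>t\<close>.\<close>

inductive exec :: "com \<Rightarrow> state \<Rightarrow> nat \<Rightarrow> state \<Rightarrow> bool" where
  exec_Const:
    "exec (Const x z) (r, m) (bits z) (r(x := z), m)"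
| exec_Arith:
    "exec (Arith f x y z) (r, m) (bits (r y) + bits (r z)) (r(x := arith_val f (r y) (r z)), m)"
| exec_Load:
    "exec (Load x y) (r, m) (bits (r y) + bits (m (r y))) (r(x := m (r y)), m)"
| exec_Store:
    "exec (Store x y) (r, m) (bits (r x) + bits (r y)) (r, m(r x := r y))"
| exec_Seq:
    "exec c1 s t1 s' \<Longrightarrow> exec c2 s' t2 s'' \<Longrightarrow> exec (Seq c1 c2) s (t1 + t2) s''"
| exec_Cond_True:
    "compare_val p (r x) (r y) \<Longrightarrow> exec c1 (r, m) t s' \<Longrightarrow>
     exec (Cond p x y c1 c2) (r, m) (bits (r x) + bits (r y) + t) s'"
| exec_Cond_False:
    "\<not> compare_val p (r x) (r y) \<Longrightarrow> exec c2 (r, m) t s' \<Longrightarrow>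
     exec (Cond p x y c1 c2) (r, m) (bits (r x) + bits (r y) + t) s'"
| exec_While_False:
    "\<not> compare_val p (r x) (r y) \<Longrightarrow>
     exec (While p x y c) (r, m) (bits (r x) + bits (r y)) (r, m)"
| exec_While_True:
    "compare_val p (r x) (r y) \<Longrightarrow> exec c (r, m) t1 s' \<Longrightarrow> exec (While p x y c) s' t2 s'' \<Longrightarrow>
     exec (While p x y c) (r, m) (bits (r x) + bits (r y) + t1 + t2) s''"

inductive_cases exec_ConstE: "exec (Const x z) s t s'"
inductive_cases exec_ArithE: "exec (Arith f x y z) s t s'"
inductive_cases exec_LoadE: "exec (Load x y) s t s'"
inductive_cases exec_StoreE: "exec (Store x y) s t s'"
inductive_cases exec_SeqE: "exec (Seq c1 c2) s t s'"
inductive_cases exec_CondE: "exec (Cond p x y c1 c2) s t s'"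
inductive_cases exec_WhileE: "exec (While p x y c) s t s'"

lemma exec_deterministic:
  "exec c s t s' \<Longrightarrow> exec c s u s'' \<Longrightarrow> t = u \<and> s' = s''"
proof (induction arbitrary: u s'' rule: exec.induct)
  case exec_Const
  then show ?case by (auto elim: exec_ConstE)
next
  case exec_Arith
  then show ?case by (auto elim: exec_ArithE)
next
  case exec_Load
  then show ?case by (auto elim: exec_LoadE)
next
  case exec_Store
  then show ?case by (auto elim: exec_StoreE)
next
  case exec_Seq
  from exec_Seq.prems show ?case
    by (rule exec_SeqE) (use exec_Seq.IH in blast)
next
  case exec_Cond_True
  from exec_Cond_True.prems show ?case
    by (rule exec_CondE) (use exec_Cond_True.IH exec_Cond_True.hyps in blast)+
next
  case exec_Cond_False
  from exec_Cond_False.prems show ?case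
    by (rule exec_CondE) (use exec_Cond_False.IH exec_Cond_False.hyps in blast)+
next
  case exec_While_False
  from exec_While_False.prems show ?case
    by (rule exec_WhileE) (use exec_While_False.hyps in blast)+
next
  case exec_While_True
  from exec_While_True.prems show ?case
    by (rule exec_WhileE) (use exec_While_True.IH exec_While_True.hyps in blast)+
qed


section \<open>Counting orthogonal vectors\<close>

definition zero_one_vectors :: "nat \<Rightarrow> nat \<Rightarrow> int list list \<Rightarrow> bool" where
  "zero_one_vectors n d us \<longleftrightarrow> length us = n \<and> (\<forall>u\<in>set us. length u = d \<and> set u \<subseteq> {0, 1})"

definition inner_prod :: "nat \<Rightarrow> int list \<Rightarrow> int list \<Rightarrow> int" where
  "inner_prod d u v = (\<Sum>k<d. u ! k * v ! k)"

definition count_OV :: "nat \<Rightarrow> nat \<Rightarrow> int list list \<Rightarrow> int list list \<Rightarrow> nat" where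
  "count_OV n d us vs = card {(i, j). i < n \<and> j < n \<and> inner_prod d (us ! i) (vs ! j) = 0}"

text \<open>
  Input: \<open>n\<close> in register 0, \<open>d\<close> in register 1, and the coordinates of \<open>u\<^sub>1, \<dots>, u\<^sub>n, v\<^sub>1, \<dots>, v\<^sub>n\<close>, one
  per cell, in memory cells \<open>0, \<dots>, 2nd - 1\<close>; all else is 0.  Output: register 0.
\<close>

definition OV_input :: "nat \<Rightarrow> nat \<Rightarrow> int list list \<Rightarrow> int list list \<Rightarrow> state" where
  "OV_input n d us vs =
     ((\<lambda>x. if x = 0 then int n else if x = 1 then int d else 0),
      (\<lambda>a. let xs = concat us @ concat vs
            in if 0 \<le> a \<and> a < int (length xs) then xs ! nat a else 0))"

definition solves_count_OV_in_time :: "com \<Rightarrow> (nat \<Rightarrow> nat \<Rightarrow> real) \<Rightarrow> bool" where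
  "solves_count_OV_in_time prog T \<longleftrightarrow>
     (\<forall>n d us vs. zero_one_vectors n d us \<longrightarrow> zero_one_vectors n d vs \<longrightarrow>
        (\<exists>t r m. exec prog (OV_input n d us vs) t (r, m) \<and>
                 r 0 = int (count_OV n d us vs) \<and> real t \<le> T n d))"

text \<open>
  \<open>soft_O f\<close> is the class \<open>O~(f(n,d))\<close>, hiding factors polynomial in \<open>d\<close> and \<open>log n\<close>.  Up to the
  constant \<open>C\<close>, every polynomial in \<open>d\<close> and \<open>log n\<close> is bounded by a power of \<open>1 + d + log n\<close>; the
  summand 1 keeps the factor positive at \<open>n = 1\<close> and \<open>d = 0\<close>.
\<close>

definition soft_O :: "(nat \<Rightarrow> nat \<Rightarrow> real) \<Rightarrow> (nat \<Rightarrow> nat \<Rightarrow> real) set" where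
  "soft_O f = {T. \<exists>(C::real) (k::nat). \<forall>n\<ge>1. \<forall>d.
     \<bar>T n d\<bar> \<le> C * (1 + real d + log 2 (real n)) ^ k * \<bar>f n d\<bar>}"

end

(*
  The 2 x 2 matrix R = [[1,1],[1,0]] of one coordinate factors as R * I, as I * R, and as
  (all ones) - (the term u = v = 1), always with two rank-one terms.  A bit u meets both terms,
  rather than one, in exactly one of these three factorizations, and so does a bit v.  If each of
  b coordinates picks one of the three at random, every row and every column of the b-fold
  Kronecker power of R therefore meets 2^X terms with X binomial of mean b/3, and 2^(1/3) < 1.26.
  By a Chernoff bound some choice is good for all but an exponentially small fraction of the rows
  and columns; the exceptional rows and columns are treated in the same way, and boundedly many
  rounds suffice.  Hence for some fixed b the power has a factorization A * B in which all rows of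
  A and all columns of B have at most s <= 1.26^b nonzero entries.  Taking d/b-fold powers of it,
  the number of orthogonal pairs is the scalar product of the sum of the rows A[u] with the sum of
  the columns B[v], which costs about n * s^(d/b) steps.  The program carries A and B for this one b
  as hard-wired tables.
*)

theory Submission
  imports Defs
begin

text \<open>\<open>2 ^ (1/3) = 1.25992...\<close> lies so close to \<open>1.26\<close> that a
  threshold between the two has a deviation probability of tiny exponential rate, while there are
  \<open>2 ^ b\<close> rows: no union bound makes one choice good for all of them. So only the area
  of the exceptional part is controlled. One round shrinks it by a factor exponential in
  \<open>b\<close>; it starts at \<open>4 ^ b\<close>, so the number of rounds does not depend on
  \<open>b\<close>, and the tripling of the row and column bounds in each round is a constant that a
  large \<open>b\<close> absorbs. Rows and columns must both be sparse, because the algorithm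
  enumerates the nonzero entries for every u and every v. The number of rank-one terms may be
  arbitrary: it enters only through bucket addresses, which have O(d) bits for fixed
  \<open>b\<close>, and no time is spent on buckets that are never hit. Good choices come from
  averaging, so the tables are shown to exist without being exhibited. This suffices, because
  \<open>b\<close> is a constant and the program a fixed text.\<close>

text \<open>The \<open>b\<close>-fold Kronecker power of \<open>R\<close>; its rows and columns are indexed by \<open>b\<close>-bit numbers.\<close>

fun disj :: "nat \<Rightarrow> nat \<Rightarrow> nat \<Rightarrow> int" where
  "disj 0 x y = 1"
| "disj (Suc b) x y = (1 - int (x mod 2) * int (y mod 2)) * disj b (x div 2) (y div 2)"

section \<open>Sums of rank-one terms, sparse in every row and column\<close>

definition nonzeros :: "('a \<Rightarrow> int) list \<Rightarrow> 'a \<Rightarrow> nat" where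
  "nonzeros fs x = length (filter (\<lambda>f. f x \<noteq> 0) fs)"

text \<open>The bounds are functions of the row and the column because a fixed choice is cheap for
  some of them and expensive for others. The length of \<open>ts\<close> is deliberately left
  free.\<close>

definition sparse_fac :: "('a \<Rightarrow> 'b \<Rightarrow> int) \<Rightarrow> ('a \<Rightarrow> nat) \<Rightarrow> ('b \<Rightarrow> nat) \<Rightarrow> bool" where
  "sparse_fac M r c \<longleftrightarrow> (\<exists>ts. (\<forall>x y. M x y = (\<Sum>(f, g)\<leftarrow>ts. f x * g y)) \<and>
     (\<forall>x. nonzeros (map fst ts) x \<le> r x) \<and> (\<forall>y. nonzeros (map snd ts) y \<le> c y))"

lemma nonzeros_simps [simp]:
  "nonzeros [] x = 0"
  "nonzeros (f # fs) x = (if f x \<noteq> 0 then 1 else 0) + nonzeros fs x"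
  "nonzeros (fs @ gs) x = nonzeros fs x + nonzeros gs x"
  by (auto simp: nonzeros_def)

lemma sparse_fac_zero: "sparse_fac (\<lambda>x y. 0) r c"
  unfolding sparse_fac_def by (rule exI[of _ "[]"]) simp

lemma sparse_fac_mono:
  assumes "sparse_fac M r c" "\<And>x. r x \<le> r' x" "\<And>y. c y \<le> c' y"
  shows "sparse_fac M r' c'"
  using assms unfolding sparse_fac_def by (meson order_trans)

lemma sparse_fac_add:
  assumes "sparse_fac M r c" "sparse_fac M' r' c'"
  shows "sparse_fac (\<lambda>x y. M x y + M' x y) (\<lambda>x. r x + r' x) (\<lambda>y. c y + c' y)"
proof -
  from assms obtain ts ts' where
    "\<forall>x y. M x y = (\<Sum>(f, g)\<leftarrow>ts. f x * g y)"
    "\<forall>x. nonzeros (map fst ts) x \<le> r x" "\<forall>y. nonzeros (map snd ts) y \<le> c y"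
    "\<forall>x y. M' x y = (\<Sum>(f, g)\<leftarrow>ts'. f x * g y)"
    "\<forall>x. nonzeros (map fst ts') x \<le> r' x" "\<forall>y. nonzeros (map snd ts') y \<le> c' y"
    unfolding sparse_fac_def by auto
  then show ?thesis
    unfolding sparse_fac_def by (intro exI[of _ "ts @ ts'"]) (simp add: add_mono)
qed

text \<open>Rows outside \<open>U\<close> and columns outside \<open>V\<close> become free, so an
  expensive row no longer spoils the bound of a rectangle that avoids it.\<close>

lemma sparse_fac_restrict:
  assumes "sparse_fac M r c"
  shows "sparse_fac (\<lambda>x y. if x \<in> U \<and> y \<in> V then M x y else 0)
           (\<lambda>x. if x \<in> U then r x else 0) (\<lambda>y. if y \<in> V then c y else 0)"
proof -
  from assms obtain ts where ts:
    "\<forall>x y. M x y = (\<Sum>(f, g)\<leftarrow>ts. f x * g y)"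
    "\<forall>x. nonzeros (map fst ts) x \<le> r x" "\<forall>y. nonzeros (map snd ts) y \<le> c y"
    unfolding sparse_fac_def by auto
  define cut where "cut = (\<lambda>(f, g).
    ((\<lambda>x. if x \<in> U then f x else (0::int)), (\<lambda>y. if y \<in> V then g y else (0::int))))"
  have "(\<Sum>(f, g)\<leftarrow>map cut ts. f x * g y) =
      (if x \<in> U \<and> y \<in> V then (\<Sum>(f, g)\<leftarrow>ts. f x * g y) else 0)" for x y
    by (induction ts) (auto simp: cut_def)
  moreover have "nonzeros (map fst (map cut ts)) x =
      (if x \<in> U then nonzeros (map fst ts) x else 0)" for x
    by (induction ts) (auto simp: cut_def split: if_splits)
  moreover have "nonzeros (map snd (map cut ts)) y =
      (if y \<in> V then nonzeros (map snd ts) y else 0)" for y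
    by (induction ts) (auto simp: cut_def split: if_splits)
  ultimately show ?thesis
    unfolding sparse_fac_def using ts by (intro exI[of _ "map cut ts"]) simp
qed

text \<open>All products of a term of one factorization with a term of the other. Such a product is
  nonzero exactly where both factors are, so the counts multiply. The maps \<open>p\<close> and
  \<open>q\<close> split an index into its two parts.\<close>

lemma sparse_fac_tensor_factor:
  assumes M: "sparse_fac M r c" and N: "sparse_fac N r' c'"
  shows "sparse_fac (\<lambda>x y. M (p x) (p y) * N (q x) (q y))
           (\<lambda>x. r (p x) * r' (q x)) (\<lambda>y. c (p y) * c' (q y))"
proof -
  from M obtain ts where ts:
    "\<forall>x y. M x y = (\<Sum>(f, g)\<leftarrow>ts. f x * g y)"
    "\<forall>x. nonzeros (map fst ts) x \<le> r x" "\<forall>y. nonzeros (map snd ts) y \<le> c y"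
    unfolding sparse_fac_def by auto
  from N obtain us where us:
    "\<forall>x y. N x y = (\<Sum>(f, g)\<leftarrow>us. f x * g y)"
    "\<forall>x. nonzeros (map fst us) x \<le> r' x" "\<forall>y. nonzeros (map snd us) y \<le> c' y"
    unfolding sparse_fac_def by auto
  define scale where "scale = (\<lambda>(f, g) (f', g').
    ((\<lambda>x. f (p x) * f' (q x) :: int), (\<lambda>y. g (p y) * g' (q y) :: int)))"
  have s1: "(\<Sum>(f, g)\<leftarrow>map (scale t) us. f x * g y) =
      fst t (p x) * snd t (p y) * (\<Sum>(f, g)\<leftarrow>us. f (q x) * g (q y))" for t x y
    by (induction us) (auto simp: scale_def algebra_simps split: prod.splits)
  have s2: "nonzeros (map fst (map (scale t) us)) x =
      (if fst t (p x) \<noteq> 0 then nonzeros (map fst us) (q x) else 0)" for t x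
    by (induction us) (auto simp: scale_def split: prod.splits)
  have s3: "nonzeros (map snd (map (scale t) us)) y =
      (if snd t (p y) \<noteq> 0 then nonzeros (map snd us) (q y) else 0)" for t y
    by (induction us) (auto simp: scale_def split: prod.splits)
  define vs where "vs = concat (map (\<lambda>t. map (scale t) us) ts)"
  have "(\<Sum>(f, g)\<leftarrow>vs. f x * g y) =
      (\<Sum>(f, g)\<leftarrow>ts. f (p x) * g (p y)) * (\<Sum>(f, g)\<leftarrow>us. f (q x) * g (q y))" for x y
    unfolding vs_def by (induction ts) (auto simp: s1 algebra_simps simp del: map_map)
  moreover have "nonzeros (map fst vs) x = nonzeros (map fst ts) (p x) * nonzeros (map fst us) (q x)" for x
    unfolding vs_def by (induction ts) (auto simp: s2 simp del: map_map)
  moreover have "nonzeros (map snd vs) y = nonzeros (map snd ts) (p y) * nonzeros (map snd us) (q y)" for y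
    unfolding vs_def by (induction ts) (auto simp: s3 simp del: map_map)
  ultimately show ?thesis
    unfolding sparse_fac_def using ts us by (intro exI[of _ vs]) (auto intro: mult_mono)
qed

section \<open>Three factorizations for one coordinate\<close>

datatype scheme = Expand_Right | Expand_Left | Subtract

fun bit_fac :: "scheme \<Rightarrow> ((nat \<Rightarrow> int) \<times> (nat \<Rightarrow> int)) list" where
  "bit_fac Expand_Right = [(\<lambda>x. 1, \<lambda>y. of_bool (y = 0)), (\<lambda>x. of_bool (x = 0), \<lambda>y. of_bool (y \<noteq> 0))]"
| "bit_fac Expand_Left = [(\<lambda>x. of_bool (x = 0), \<lambda>y. 1), (\<lambda>x. of_bool (x \<noteq> 0), \<lambda>y. of_bool (y = 0))]"
| "bit_fac Subtract = [(\<lambda>x. 1, \<lambda>y. 1), (\<lambda>x. - of_bool (x \<noteq> 0), \<lambda>y. of_bool (y \<noteq> 0))]"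

text \<open>Base-2 logarithm of the number of left factors in \<open>bit_fac \<sigma>\<close> that
  do not vanish at \<open>x\<close>; costs add up over the coordinates where term counts
  multiply.\<close>

definition left_cost :: "scheme \<Rightarrow> nat \<Rightarrow> nat" where
  "left_cost \<sigma> x = of_bool (\<sigma> = Expand_Right \<and> x = 0 \<or> \<sigma> = Subtract \<and> x \<noteq> 0)"

definition right_cost :: "scheme \<Rightarrow> nat \<Rightarrow> nat" where
  "right_cost \<sigma> y = of_bool (\<sigma> = Expand_Left \<and> y = 0 \<or> \<sigma> = Subtract \<and> y \<noteq> 0)"

fun total_cost :: "(scheme \<Rightarrow> nat \<Rightarrow> nat) \<Rightarrow> scheme list \<Rightarrow> nat \<Rightarrow> nat" where
  "total_cost c [] x = 0"
| "total_cost c (\<sigma> # \<phi>) x = c \<sigma> (x mod 2) + total_cost c \<phi> (x div 2)"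

lemma sparse_fac_bit:
  "sparse_fac (\<lambda>x y. if x = 0 \<or> y = 0 then 1 else 0)
     (\<lambda>x. 2 ^ left_cost \<sigma> x) (\<lambda>y. 2 ^ right_cost \<sigma> y)"
  unfolding sparse_fac_def
  by (rule exI[of _ "bit_fac \<sigma>"]) (cases \<sigma>; auto simp: left_cost_def right_cost_def)

lemma sparse_fac_disj:
  "sparse_fac (disj (length \<phi>)) (\<lambda>x. 2 ^ total_cost left_cost \<phi> x) (\<lambda>y. 2 ^ total_cost right_cost \<phi> y)"
proof (induction \<phi>)
  case Nil
  show ?case
    unfolding sparse_fac_def by (rule exI[of _ "[(\<lambda>x. 1, \<lambda>y. 1)]"]) simp
next
  case (Cons \<sigma> \<phi>)
  have "disj (length (\<sigma> # \<phi>)) = (\<lambda>x y. (if x mod 2 = 0 \<or> y mod 2 = 0 then 1 else 0) *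
      disj (length \<phi>) (x div 2) (y div 2))"
    by (intro ext) (auto simp: mod2_eq_if)
  then show ?case
    using sparse_fac_tensor_factor[OF sparse_fac_bit[of \<sigma>] Cons.IH,
        of "\<lambda>x. x mod 2" "\<lambda>x. x div 2"]
    by (simp add: power_add)
qed

section \<open>Uniformly random schemes: generating function and averaging\<close>

definition schemes :: "nat \<Rightarrow> scheme list set" where
  "schemes b = {\<phi>. length \<phi> = b}"

lemma UNIV_scheme: "UNIV = {Expand_Right, Expand_Left, Subtract}"
  using scheme.exhaust by auto

lemma schemes_0: "schemes 0 = {[]}"
  by (auto simp: schemes_def)

lemma schemes_Suc: "schemes (Suc b) = (\<lambda>(\<sigma>, \<phi>). \<sigma> # \<phi>) ` (UNIV \<times> schemes b)"
  by (auto simp: schemes_def length_Suc_conv image_iff)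

lemma sum_schemes_Suc:
  fixes F :: "scheme list \<Rightarrow> 'a::comm_monoid_add"
  shows "(\<Sum>\<phi>\<in>schemes (Suc b). F \<phi>) = (\<Sum>\<sigma>\<in>UNIV. \<Sum>\<phi>\<in>schemes b. F (\<sigma> # \<phi>))"
  unfolding schemes_Suc
  by (subst sum.reindex) (auto simp: inj_on_def sum.cartesian_product case_prod_unfold)

lemma finite_schemes: "finite (schemes b)"
  by (induction b) (auto simp: schemes_0 schemes_Suc UNIV_scheme)

lemma card_schemes: "card (schemes b) = 3 ^ b"
proof (induction b)
  case (Suc b)
  then show ?case using sum_schemes_Suc[of "\<lambda>_. 1::nat" b] by (simp add: UNIV_scheme)
qed (simp add: schemes_0)

text \<open>Up to the factor \<open>3 ^ b\<close> this is the generating function of a sum of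
  \<open>b\<close> independent costs: each coordinate contributes \<open>z\<close> for its one
  expensive scheme and 1 for each of the two cheap ones.\<close>

lemma sum_schemes_power:
  fixes z :: "'a::comm_semiring_1"
  assumes "\<And>x. (\<Sum>\<sigma>\<in>UNIV. z ^ c \<sigma> x) = z + 2"
  shows "(\<Sum>\<phi>\<in>schemes b. z ^ total_cost c \<phi> x) = (z + 2) ^ b"
proof (induction b arbitrary: x)
  case (Suc b)
  have "(\<Sum>\<phi>\<in>schemes (Suc b). z ^ total_cost c \<phi> x) =
      (\<Sum>\<sigma>\<in>UNIV. z ^ c \<sigma> (x mod 2) * (\<Sum>\<phi>\<in>schemes b. z ^ total_cost c \<phi> (x div 2)))"
    by (simp add: sum_schemes_Suc power_add sum_distrib_left)
  also have "\<dots> = (z + 2) ^ Suc b"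
    by (simp add: Suc.IH assms flip: sum_distrib_right)
  finally show ?case .
qed (simp add: schemes_0)

text \<open>Whatever its bit, a coordinate is expensive under exactly one of the three schemes.\<close>

lemma sum_power_left_cost: "(\<Sum>\<sigma>\<in>UNIV. (z::real) ^ left_cost \<sigma> x) = z + 2"
  by (simp add: UNIV_scheme left_cost_def)

lemma sum_power_right_cost: "(\<Sum>\<sigma>\<in>UNIV. (z::real) ^ right_cost \<sigma> x) = z + 2"
  by (simp add: UNIV_scheme right_cost_def)

text \<open>Markov's inequality for \<open>z ^ total_cost c \<phi> x\<close>, added up over the rows
  in \<open>U\<close> and cleared of denominators; swapping the sums averages over the schemes for a
  fixed row.\<close>

lemma sum_card_expensive_le:
  fixes z :: real
  assumes "finite U" "z \<ge> 1" "\<And>x. (\<Sum>\<sigma>\<in>UNIV. z ^ c \<sigma> x) = z + 2"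
  shows "(\<Sum>\<phi>\<in>schemes b. real (card {x\<in>U. total_cost c \<phi> x > \<theta>})) * z ^ \<theta> \<le> real (card U) * (z + 2) ^ b"
proof -
  have "(\<Sum>\<phi>\<in>schemes b. real (card {x\<in>U. total_cost c \<phi> x > \<theta>})) * z ^ \<theta> =
      (\<Sum>\<phi>\<in>schemes b. \<Sum>x\<in>U. if total_cost c \<phi> x > \<theta> then z ^ \<theta> else 0)"
    using assms(1) by (simp add: sum_distrib_right sum.If_cases Int_def)
  also have "\<dots> \<le> (\<Sum>\<phi>\<in>schemes b. \<Sum>x\<in>U. z ^ total_cost c \<phi> x)"
    using assms(2) by (intro sum_mono) (auto intro: power_increasing)
  also have "\<dots> = (\<Sum>x\<in>U. \<Sum>\<phi>\<in>schemes b. z ^ total_cost c \<phi> x)"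
    by (rule sum.swap)
  also have "\<dots> = real (card U) * (z + 2) ^ b"
    by (simp add: sum_schemes_power[OF assms(3)])
  finally show ?thesis .
qed

text \<open>The hypothesis on \<open>D\<close> makes the mean fraction of expensive rows, and
  likewise of expensive columns, at most \<open>1 / (2 * D)\<close>. Averaging the sum of both
  fractions yields one scheme that is good for the two sides at once.\<close>

lemma good_scheme_exists:
  fixes z D :: real
  assumes "finite U" "finite V" "U \<noteq> {}" "V \<noteq> {}" "z \<ge> 1" "D > 0"
    and D: "2 * D * (z + 2) ^ b \<le> 3 ^ b * z ^ \<theta>"
  obtains \<phi> where "\<phi> \<in> schemes b"
    "D * card {x\<in>U. total_cost left_cost \<phi> x > \<theta>} \<le> card U"
    "D * card {y\<in>V. total_cost right_cost \<phi> y > \<theta>} \<le> card V"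
proof -
  define p where "p \<phi> = real (card {x\<in>U. total_cost left_cost \<phi> x > \<theta>}) / card U" for \<phi>
  define q where "q \<phi> = real (card {y\<in>V. total_cost right_cost \<phi> y > \<theta>}) / card V" for \<phi>
  have pos: "card U > 0" "card V > 0" using assms by (auto simp: card_gt_0_iff)
  have "(\<Sum>\<phi>\<in>schemes b. p \<phi>) * z ^ \<theta> \<le> (z + 2) ^ b" "(\<Sum>\<phi>\<in>schemes b. q \<phi>) * z ^ \<theta> \<le> (z + 2) ^ b"
    using sum_card_expensive_le[OF \<open>finite U\<close> \<open>z \<ge> 1\<close> sum_power_left_cost, where b = b and \<theta> = \<theta>]
      sum_card_expensive_le[OF \<open>finite V\<close> \<open>z \<ge> 1\<close> sum_power_right_cost, where b = b and \<theta> = \<theta>] pos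
    by (auto simp: p_def q_def sum_divide_distrib[symmetric] field_simps)
  then have "(\<Sum>\<phi>\<in>schemes b. p \<phi> + q \<phi>) * z ^ \<theta> \<le> 2 * (z + 2) ^ b"
    by (simp add: sum.distrib algebra_simps)
  then have "D * ((\<Sum>\<phi>\<in>schemes b. p \<phi> + q \<phi>) * z ^ \<theta>) \<le> D * (2 * (z + 2) ^ b)"
    using \<open>D > 0\<close> by (intro mult_left_mono) auto
  then have "(\<Sum>\<phi>\<in>schemes b. D * (p \<phi> + q \<phi>)) * z ^ \<theta> \<le> 3 ^ b * z ^ \<theta>"
    using D by (simp add: sum_distrib_left[symmetric] mult.assoc mult.left_commute)
  then have le: "(\<Sum>\<phi>\<in>schemes b. D * (p \<phi> + q \<phi>)) \<le> (\<Sum>\<phi>\<in>schemes b. 1)"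
    using \<open>z \<ge> 1\<close> by (simp add: card_schemes)
  have "\<exists>\<phi>\<in>schemes b. D * (p \<phi> + q \<phi>) \<le> 1"
  proof (rule ccontr)
    assume "\<not> ?thesis"
    then have "(\<Sum>\<phi>\<in>schemes b. 1) < (\<Sum>\<phi>\<in>schemes b. D * (p \<phi> + q \<phi>))"
      using card_schemes[of b] by (intro sum_strict_mono) (auto simp: finite_schemes not_le)
    with le show False by simp
  qed
  then obtain \<phi> where \<phi>: "\<phi> \<in> schemes b" "D * (p \<phi> + q \<phi>) \<le> 1" by blast
  have "0 \<le> D * p \<phi>" "0 \<le> D * q \<phi>" using \<open>D > 0\<close> by (auto simp: p_def q_def)
  with \<phi>(2) have "D * p \<phi> \<le> 1" "D * q \<phi> \<le> 1" by (auto simp: algebra_simps)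
  then show ?thesis using that[OF \<phi>(1)] pos by (auto simp: p_def q_def field_simps)
qed

text \<open>
  Under the chosen scheme the rectangle of cheap rows and cheap columns is sparse; the expensive
  rows and the expensive columns leave two rectangles, each smaller by the factor \<open>D\<close>.
\<close>

lemma sparse_fac_disj_rectangle:
  fixes z D :: real
  assumes "z \<ge> 1" "D > 0" and D: "2 * D * (z + 2) ^ b \<le> 3 ^ b * z ^ \<theta>"
    and "finite U" "finite V" "real (card U) * real (card V) < D ^ k"
  shows "sparse_fac (\<lambda>x y. if x \<in> U \<and> y \<in> V then disj b x y else 0)
           (\<lambda>x. 3 ^ k * 2 ^ \<theta>) (\<lambda>y. 3 ^ k * 2 ^ \<theta>)"
  using assms(4-)
proof (induction k arbitrary: U V)
  case 0
  then have "card U * card V < 1" by (metis of_nat_1 of_nat_less_iff of_nat_mult power_0)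
  then have "U = {} \<or> V = {}" using 0 by auto
  then have "(\<lambda>x y. if x \<in> U \<and> y \<in> V then disj b x y else 0) = (\<lambda>x y. 0)" by auto
  then show ?case using sparse_fac_zero by metis
next
  case (Suc k)
  show ?case
  proof (cases "U = {} \<or> V = {}")
    case True
    then have "(\<lambda>x y. if x \<in> U \<and> y \<in> V then disj b x y else 0) = (\<lambda>x y. 0)" by auto
    then show ?thesis using sparse_fac_zero by metis
  next
    case False
    then obtain \<phi> where \<phi>: "\<phi> \<in> schemes b"
      "D * card {x\<in>U. total_cost left_cost \<phi> x > \<theta>} \<le> card U"
      "D * card {y\<in>V. total_cost right_cost \<phi> y > \<theta>} \<le> card V"
      using good_scheme_exists[OF Suc.prems(1,2) _ _ assms(1-3)] by auto
    define U1 where "U1 = {x\<in>U. total_cost left_cost \<phi> x > \<theta>}"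
    define V1 where "V1 = {y\<in>V. total_cost right_cost \<phi> y > \<theta>}"
    define R where "R U V = (\<lambda>x y. if x \<in> U \<and> y \<in> V then disj b x y else 0)" for U V
    have "sparse_fac (R (U - U1) (V - V1)) (\<lambda>x. 2 ^ \<theta>) (\<lambda>y. 2 ^ \<theta>)"
      unfolding R_def
      by (rule sparse_fac_mono[OF sparse_fac_restrict[OF sparse_fac_disj[of \<phi>, unfolded \<phi>(1)[unfolded schemes_def mem_Collect_eq]]]])
        (auto simp: U1_def V1_def)
    \<comment> \<open>Pairing \<open>U1\<close> with all of \<open>V\<close>, but \<open>V1\<close>
      only with \<open>U - U1\<close>, makes the three rectangles a partition of
      \<open>U \<times> V\<close>. Each piece is bounded by \<open>3 ^ k * 2 ^ \<theta>\<close>,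
      whence the factor 3 per round.\<close>
    moreover have "sparse_fac (R U1 V) (\<lambda>x. 3 ^ k * 2 ^ \<theta>) (\<lambda>y. 3 ^ k * 2 ^ \<theta>)"
      unfolding R_def
    proof (rule Suc.IH)
      have "D * (real (card U1) * real (card V)) \<le> real (card U) * real (card V)"
        using mult_right_mono[OF \<phi>(2), of "real (card V)"] by (simp add: U1_def mult.assoc)
      also note Suc.prems(3)
      finally show "real (card U1) * real (card V) < D ^ k" using \<open>D > 0\<close> by simp
    qed (use Suc.prems in \<open>auto simp: U1_def\<close>)
    moreover have "sparse_fac (R (U - U1) V1) (\<lambda>x. 3 ^ k * 2 ^ \<theta>) (\<lambda>y. 3 ^ k * 2 ^ \<theta>)"
      unfolding R_def
    proof (rule Suc.IH)
      have "D * (real (card (U - U1)) * real (card V1)) = real (card (U - U1)) * (D * real (card V1))"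
        by simp
      also have "\<dots> \<le> real (card U) * real (card V)"
        using \<phi>(3) \<open>D > 0\<close> Suc.prems(1) by (intro mult_mono) (auto simp: V1_def intro: card_mono)
      also note Suc.prems(3)
      finally show "real (card (U - U1)) * real (card V1) < D ^ k" using \<open>D > 0\<close> by simp
    qed (use Suc.prems in \<open>auto simp: V1_def\<close>)
    ultimately have "sparse_fac (\<lambda>x y. R (U - U1) (V - V1) x y + (R U1 V x y + R (U - U1) V1 x y))
       (\<lambda>x. 2 ^ \<theta> + (3 ^ k * 2 ^ \<theta> + 3 ^ k * 2 ^ \<theta>)) (\<lambda>x. 2 ^ \<theta> + (3 ^ k * 2 ^ \<theta> + 3 ^ k * 2 ^ \<theta>))"
      by (intro sparse_fac_add)
    moreover have "(\<lambda>x y. R (U - U1) (V - V1) x y + (R U1 V x y + R (U - U1) V1 x y)) = R U V"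
      by (intro ext) (auto simp: R_def U1_def V1_def)
    ultimately have "sparse_fac (R U V)
       (\<lambda>x. 2 ^ \<theta> + (3 ^ k * 2 ^ \<theta> + 3 ^ k * 2 ^ \<theta>)) (\<lambda>x. 2 ^ \<theta> + (3 ^ k * 2 ^ \<theta> + 3 ^ k * 2 ^ \<theta>))"
      by simp
    moreover have "(2::nat) ^ \<theta> + (3 ^ k * 2 ^ \<theta> + 3 ^ k * 2 ^ \<theta>) \<le> 3 ^ Suc k * 2 ^ \<theta>" by simp
    ultimately show ?thesis unfolding R_def by (elim sparse_fac_mono)
  qed
qed

text \<open>
  The exponent \<open>0.3334\<close> of the good factorizations lies between \<open>1 / 3\<close> and \<open>log 2 1.26 = 0.33342...\<close>;
  the Chernoff bound at the threshold \<open>0.3334\<close> is nontrivial for the parameter \<open>z = 1 + 1 / 10000\<close>.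
\<close>

lemma power_126_ge: "(1.26::real) ^ 10000 \<ge> 1.02 * 2 ^ 3334"
proof -
  \<comment> \<open>\<open>1.26 ^ 3 = 2.000376 = 2 * 1.000188\<close>, and Bernoulli gives
    \<open>1.000188 ^ 3333 \<ge> 1.6266\<close>. One more factor \<open>1.26\<close> makes this at
    least \<open>1.62 * 1.26 = 2.0412\<close>, enough for \<open>2 * 1.02\<close>.\<close>
  have "1 + real 3333 * 0.000188 \<le> (1 + 0.000188 :: real) ^ 3333"
    by (rule Bernoulli_inequality) simp
  then have "2 ^ 3333 * 1.62 \<le> (2::real) ^ 3333 * 1.000188 ^ 3333"
    by (intro mult_left_mono) auto
  also have "\<dots> = (2 * 1.000188) ^ 3333" by (rule power_mult_distrib[symmetric])
  also have "(2 * 1.000188 :: real) = 1.26 ^ 3" by (simp add: power3_eq_cube)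
  also have "((1.26::real) ^ 3) ^ 3333 = 1.26 ^ 9999" by (simp only: power_mult[symmetric]) simp
  finally have "2 ^ 3333 * 1.62 * 1.26 \<le> (1.26::real) ^ 9999 * 1.26" by (intro mult_right_mono) auto
  then have "2 ^ 3333 * 2 * 1.02 \<le> (1.26::real) ^ 9999 * 1.26" by simp
  then have "2 ^ Suc 3333 * 1.02 \<le> (1.26::real) ^ Suc 9999" unfolding power_Suc2 .
  then show ?thesis
    by (simp only: mult.commute[of "1.02::real"]) (simp only: eval_nat_numeral BitM.simps)
qed

lemma chernoff_constant:
  fixes z :: real
  defines "z \<equiv> 1 + 1 / 10000"
  shows "((z + 2) / 3) ^ 10000 < z ^ 3334"
proof -
  have "10000 * ln ((z + 2) / 3) = 10000 * ln (1 + 1 / 30000 :: real)" by (simp add: z_def)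
  also have "\<dots> \<le> 10000 * (1 / 30000)" by (intro mult_left_mono ln_add_one_self_le_self) auto
  \<comment> \<open>\<open>0.33333... < 0.33336666\<close>. The surplus of \<open>0.3334\<close>
    over \<open>1/3\<close> is linear in \<open>z - 1\<close> and the loss in \<open>ln z\<close>
    quadratic, which is why \<open>z - 1\<close> has to be so small.\<close>
  also have "\<dots> < 3334 * (1 / 10000 - (1 / 10000)\<^sup>2 :: real)" by (simp add: power2_eq_square)
  also have "\<dots> \<le> 3334 * ln z"
    unfolding z_def by (intro mult_left_mono ln_one_plus_pos_lower_bound) auto
  finally have "ln (((z + 2) / 3) ^ 10000) < ln (z ^ 3334)"
    by (simp add: ln_realpow z_def)
  then show ?thesis by (subst (asm) ln_less_cancel_iff) (auto simp: z_def)
qed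

lemma eventually_power_gt:
  fixes r c :: real
  assumes "r > 1"
  obtains N0 where "\<And>N. N \<ge> N0 \<Longrightarrow> r ^ N > c"
proof -
  obtain N0 where "c < r ^ N0" using real_arch_pow[OF assms] by blast
  then have "c < r ^ N" if "N \<ge> N0" for N
    using power_increasing[OF that, of r] assms by linarith
  then show ?thesis using that by blast
qed

text \<open>The order of the choices matters. \<open>Q\<close> is the Chernoff gain per 10000
  coordinates, and \<open>Q ^ k' > 4 ^ 10000\<close> fixes a number of rounds that exhausts the area
  \<open>4 ^ b\<close> for every large \<open>N\<close>; it is doubled because \<open>D\<close>,
  with its loss of \<open>1/2\<close>, is only known to satisfy \<open>D\<^sup>2 > Q ^ N\<close>.
  Only then is \<open>N\<close> taken so large that \<open>1.02 ^ N\<close>, the slack in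
  \<open>1.26 ^ b\<close>, exceeds \<open>3 ^ k\<close>.\<close>

lemma sparse_fac_disj_exists:
  obtains b s where "b > 0" "s > 0" "real s \<le> 1.26 ^ b"
    "sparse_fac (\<lambda>x y. if x < 2 ^ b \<and> y < 2 ^ b then disj b x y else 0) (\<lambda>x. s) (\<lambda>y. s)"
proof -
  define z :: real where "z = 1 + 1 / 10000"
  define Q :: real where "Q = z ^ 3334 / ((z + 2) / 3) ^ 10000"
  have z: "z \<ge> 1" "z > 0" by (auto simp: z_def)
  have pos: "0 < ((z + 2) / 3) ^ 10000" using z by (intro zero_less_power) auto
  have Q: "Q > 1" using chernoff_constant pos by (simp add: Q_def z_def[symmetric] del: power_divide)
  obtain k' where k': "Q ^ k' > 4 ^ 10000" using eventually_power_gt[OF Q] by blast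
  define k where "k = 2 * k'"
  obtain N1 where N1: "\<And>N. N \<ge> N1 \<Longrightarrow> Q ^ N > 4" using eventually_power_gt[OF Q] by blast
  obtain N2 where N2: "\<And>N. N \<ge> N2 \<Longrightarrow> (1.02::real) ^ N > 3 ^ k"
    using eventually_power_gt[of "1.02" "3 ^ k"] by auto
  define N where "N = N1 + N2 + 1"
  define b where "b = 10000 * N"
  define \<theta> where "\<theta> = 3334 * N"
  \<comment> \<open>The largest value that the averaging hypothesis admits; it then holds with
    equality.\<close>
  define D where "D = Q ^ N / 2"
  have N: "Q ^ N > 4" "(1.02::real) ^ N > 3 ^ k" "N > 0"
    using N1[of N] N2[of N] by (auto simp: N_def simp del: power_Suc)
  have "D > 0" using N(1) unfolding D_def by linarith
  have "2 * D * ((z + 2) / 3) ^ b = (Q * ((z + 2) / 3) ^ 10000) ^ N"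
    by (simp add: D_def b_def power_mult power_mult_distrib del: power_divide)
  also have "Q * ((z + 2) / 3) ^ 10000 = z ^ 3334" using pos by (simp add: Q_def del: power_divide)
  also have "(z ^ 3334) ^ N = z ^ \<theta>" by (simp only: \<theta>_def power_mult)
  finally have "2 * D * (z + 2) ^ b = 3 ^ b * z ^ \<theta>"
    by (simp add: power_divide field_simps)
  then have D: "2 * D * (z + 2) ^ b \<le> 3 ^ b * z ^ \<theta>" by simp
  have "D \<ge> 0" "D\<^sup>2 > Q ^ N"
  proof -
    show "D \<ge> 0" using \<open>D > 0\<close> by simp
    have "D\<^sup>2 = Q ^ N * (Q ^ N / 4)" by (simp add: D_def power2_eq_square)
    also have "\<dots> > Q ^ N * 1" using N(1) by (intro mult_strict_left_mono) auto
    finally show "D\<^sup>2 > Q ^ N" by simp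
  qed
  have "real (card {..<2 ^ b :: nat}) * real (card {..<2 ^ b :: nat}) = 4 ^ b"
    by (simp add: power_mult_distrib[symmetric])
  also have "\<dots> = (4 ^ 10000) ^ N" by (simp only: b_def power_mult)
  also have "\<dots> < (Q ^ k') ^ N" by (rule power_strict_mono[OF k' _ N(3)]) (rule zero_le_power, simp)
  also have "\<dots> = (Q ^ N) ^ k'" by (metis power_mult mult.commute)
  also have "\<dots> \<le> (D\<^sup>2) ^ k'" using \<open>D\<^sup>2 > Q ^ N\<close> N(1) by (intro power_mono) auto
  also have "\<dots> = D ^ k" by (simp only: k_def power_mult)
  finally have "sparse_fac (\<lambda>x y. if x \<in> {..<2 ^ b} \<and> y \<in> {..<2 ^ b} then disj b x y else 0)
      (\<lambda>x. 3 ^ k * 2 ^ \<theta>) (\<lambda>y. 3 ^ k * 2 ^ \<theta>)"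
    using z \<open>D > 0\<close> D by (intro sparse_fac_disj_rectangle) auto
  moreover have "real (3 ^ k * 2 ^ \<theta>) \<le> 1.26 ^ b"
  proof -
    have "real (3 ^ k * 2 ^ \<theta>) = 3 ^ k * (2 ^ 3334) ^ N"
      by (simp only: of_nat_mult of_nat_power of_nat_numeral \<theta>_def power_mult)
    also have "\<dots> \<le> 1.02 ^ N * (2 ^ 3334) ^ N" using N(2) by (intro mult_right_mono) auto
    also have "\<dots> = (1.02 * 2 ^ 3334) ^ N" by (simp only: power_mult_distrib)
    also have "\<dots> \<le> (1.26 ^ 10000) ^ N" using power_126_ge by (intro power_mono) auto
    also have "\<dots> = 1.26 ^ b" by (simp only: b_def power_mult)
    finally show ?thesis .
  qed
  ultimately show ?thesis using that[of b "3 ^ k * 2 ^ \<theta>"] N(3) by (simp add: b_def)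
qed

section \<open>Factorizations as tables, digit by digit\<close>

text \<open>Every row is padded to exactly \<open>s\<close> entries, so that an entry can be chosen
  by a base-\<open>s\<close> digit. Padding has the dummy position \<open>length fs\<close> and the
  value 0.\<close>

lemma nonzero_positions:
  fixes fs :: "('a \<Rightarrow> int) list"
  assumes "\<And>x. nonzeros fs x \<le> s"
  obtains p q where "\<And>x e. p x e \<le> length fs" "\<And>x e. p x e = length fs \<Longrightarrow> q x e = 0"
    "\<And>x t. t < length fs \<Longrightarrow> (\<Sum>e<s. if p x e = t then q x e else 0) = (fs ! t) x"
proof -
  define ps where "ps x = filter (\<lambda>t. (fs ! t) x \<noteq> 0) [0..<length fs]" for x
  define p where "p x e = (if e < length (ps x) then ps x ! e else length fs)" for x e
  define q where "q x e = (if e < length (ps x) then (fs ! (ps x ! e)) x else 0)" for x e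
  have set_ps: "set (ps x) = {t. t < length fs \<and> (fs ! t) x \<noteq> 0}" for x
    by (auto simp: ps_def)
  have len: "length (ps x) \<le> s" for x
  proof -
    have "nonzeros fs x = nonzeros (map ((!) fs) [0..<length fs]) x" by (simp add: map_nth)
    also have "\<dots> = length (ps x)" by (simp add: nonzeros_def ps_def filter_map comp_def)
    finally show ?thesis using assms[of x] by simp
  qed
  have ps_lt: "ps x ! e < length fs" if "e < length (ps x)" for x e
    using nth_mem[OF that] set_ps by auto
  have "p x e \<le> length fs" "p x e = length fs \<Longrightarrow> q x e = 0" for x e
    using ps_lt[of e x] by (auto simp: p_def q_def)
  moreover have "(\<Sum>e<s. if p x e = t then q x e else 0) = (fs ! t) x" if "t < length fs" for x t
  proof -
    have "(\<Sum>e<s. if p x e = t then q x e else 0) =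
        (\<Sum>e<length (ps x). if ps x ! e = t then (fs ! t) x else 0)"
      using len[of x] that by (intro sum.mono_neutral_cong_right) (auto simp: p_def q_def)
    also have "\<dots> = sum_list (map (\<lambda>t'. if t' = t then (fs ! t) x else 0) (ps x))"
      by (simp add: sum_list_sum_nth atLeast0LessThan)
    also have "\<dots> = (\<Sum>t'\<in>set (ps x). if t' = t then (fs ! t) x else 0)"
      by (intro sum_list_distinct_conv_sum_set) (simp add: ps_def)
    also have "\<dots> = (fs ! t) x" using that set_ps by auto
    finally show ?thesis .
  qed
  ultimately show ?thesis using that by blast
qed

text \<open>A matrix entry becomes a scalar product of two sparse lists matched by position, the
  form in which left and right vectors can be processed separately.\<close>

lemma sparse_tables:
  assumes "sparse_fac M (\<lambda>x. s) (\<lambda>y. s)"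
  obtains m f f' h h' where "m > 0" "\<And>x e. f x e < (m::nat)" "\<And>y e. f' y e < m"
    "\<And>x y. M x y = (\<Sum>e<s. \<Sum>e'<s. if f x e = f' y e' then h x e * h' y e' else 0)"
proof -
  from assms obtain ts where ts:
    "\<forall>x y. M x y = (\<Sum>(f, g)\<leftarrow>ts. f x * g y)"
    "\<And>x. nonzeros (map fst ts) x \<le> s" "\<And>y. nonzeros (map snd ts) y \<le> s"
    unfolding sparse_fac_def by auto
  obtain f h where f: "\<And>x e. f x e \<le> length (map fst ts)"
    "\<And>x e. f x e = length (map fst ts) \<Longrightarrow> h x e = 0"
    "\<And>x t. t < length (map fst ts) \<Longrightarrow> (\<Sum>e<s. if f x e = t then h x e else 0) = (map fst ts ! t) x"
    using nonzero_positions[OF ts(2)] by blast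
  obtain f' h' where f': "\<And>x e. f' x e \<le> length (map snd ts)"
    "\<And>x e. f' x e = length (map snd ts) \<Longrightarrow> h' x e = 0"
    "\<And>x t. t < length (map snd ts) \<Longrightarrow> (\<Sum>e<s. if f' x e = t then h' x e else 0) = (map snd ts ! t) x"
    using nonzero_positions[OF ts(3)] by blast
  show ?thesis
  \<comment> \<open>\<open>Suc\<close> makes room for the dummy position of the padding; two padded
    entries do match there, but with weight 0.\<close>
  proof (rule that[of "Suc (length ts)" f f' h h'])
    show "f x e < Suc (length ts)" "f' y e < Suc (length ts)" for x y e
      using f(1) f'(1) by (simp_all add: less_Suc_eq_le)
    fix x y
    have "M x y = (\<Sum>t<length ts. (map fst ts ! t) x * (map snd ts ! t) y)"
      by (simp add: ts(1) sum_list_sum_nth atLeast0LessThan case_prod_unfold)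
    also have "\<dots> = (\<Sum>t<length ts. \<Sum>e<s. \<Sum>e'<s. if f x e = t \<and> f' y e' = t then h x e * h' y e' else 0)"
    proof (rule sum.cong[OF refl])
      fix t assume "t \<in> {..<length ts}"
      then have "(map fst ts ! t) x * (map snd ts ! t) y =
          (\<Sum>e<s. if f x e = t then h x e else 0) * (\<Sum>e<s. if f' y e = t then h' y e else 0)"
        using f(3)[of t x] f'(3)[of t y] by simp
      also have "\<dots> = (\<Sum>e<s. \<Sum>e'<s. if f x e = t \<and> f' y e' = t then h x e * h' y e' else 0)"
        unfolding sum_product by (intro sum.cong) auto
      finally show "(map fst ts ! t) x * (map snd ts ! t) y = \<dots>" .
    qed
    also have "\<dots> = (\<Sum>e<s. \<Sum>t<length ts. \<Sum>e'<s. if f x e = t \<and> f' y e' = t then h x e * h' y e' else 0)"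
      by (rule sum.swap)
    also have "\<dots> = (\<Sum>e<s. \<Sum>e'<s. \<Sum>t<length ts. if f x e = t \<and> f' y e' = t then h x e * h' y e' else 0)"
      by (intro sum.cong[OF refl] sum.swap)
    also have "\<dots> = (\<Sum>e<s. \<Sum>e'<s. if f x e = f' y e' then h x e * h' y e' else 0)"
    proof (intro sum.cong[OF refl])
      fix e e'
      have "(\<Sum>t<length ts. if f x e = t \<and> f' y e' = t then h x e * h' y e' else 0) =
          (\<Sum>t<length ts. if t = f x e then if f x e = f' y e' then h x e * h' y e' else 0 else 0)"
        by (intro sum.cong) auto
      also have "\<dots> = (if f x e = f' y e' then h x e * h' y e' else 0)"
        using f(1,2)[of x e] by auto
      finally show "(\<Sum>t<length ts. if f x e = t \<and> f' y e' = t then h x e * h' y e' else 0) = \<dots>" .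
    qed
    finally show "M x y = \<dots>" .
  qed simp
qed

section \<open>Codes of blocks and of choices of terms\<close>

fun block_code :: "(nat \<Rightarrow> nat) \<Rightarrow> nat \<Rightarrow> nat \<Rightarrow> nat" where
  "block_code w p 0 = 0"
| "block_code w p (Suc k) = 2 * block_code w p k + w (p + k)"

lemma block_code_less:
  assumes "\<And>q. w q < 2"
  shows "block_code w p k < 2 ^ k"
proof (induction k)
  case (Suc k)
  then show ?case using assms[of "p + k"] by simp
qed simp

text \<open>Both recursions peel off the last coordinate, which is the lowest bit of the
  code.\<close>

lemma disj_block_code:
  assumes "\<And>q. w q < 2" "\<And>q. w' q < 2"
  shows "disj k (block_code w p k) (block_code w' p k) = (\<Prod>q<k. 1 - int (w (p + q)) * int (w' (p + q)))"
proof (induction k)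
  case (Suc k)
  have "w (p + k) mod 2 = w (p + k)" "w (p + k) div 2 = 0"
    "w' (p + k) mod 2 = w' (p + k)" "w' (p + k) div 2 = 0"
    using assms[of "p + k"] by auto
  then show ?case using Suc by (simp add: mod_simps)
qed simp

text \<open>Base-\<open>s\<close> digit \<open>j\<close> of \<open>c\<close> chooses an entry of the
  list belonging to block \<open>j\<close>. The positions of the chosen entries are read as one
  base-\<open>m\<close> number, so that a whole tuple of positions fits into a single bucket
  address.\<close>

fun index :: "nat \<Rightarrow> nat \<Rightarrow> nat \<Rightarrow> (nat \<Rightarrow> nat \<Rightarrow> nat) \<Rightarrow> (nat \<Rightarrow> nat) \<Rightarrow> nat \<Rightarrow> nat \<Rightarrow> nat" where
  "index b s m f w c 0 = 0"
| "index b s m f w c (Suc j) = index b s m f w c j * m + f (block_code w (j * b) b) (c div s ^ j mod s)"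

fun weight :: "nat \<Rightarrow> nat \<Rightarrow> (nat \<Rightarrow> nat \<Rightarrow> int) \<Rightarrow> (nat \<Rightarrow> nat) \<Rightarrow> nat \<Rightarrow> nat \<Rightarrow> int" where
  "weight b s h w c 0 = 1"
| "weight b s h w c (Suc j) = weight b s h w c j * h (block_code w (j * b) b) (c div s ^ j mod s)"

lemma index_less:
  assumes "\<And>x e. f x e < m"
  shows "index b s m f w c j < m ^ j"
proof (induction j)
  case (Suc j)
  then have "index b s m f w c j * m + m \<le> m ^ j * m"
    using mult_le_mono1[of "Suc (index b s m f w c j)" "m ^ j" m] by simp
  then show ?case using assms[of "block_code w (j * b) b" "c div s ^ j mod s"] by (simp add: mult.commute)
qed simp

lemma digit_add:
  fixes c e s :: nat
  assumes "j < g"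
  shows "(c + e * s ^ g) div s ^ j mod s = c div s ^ j mod s"
proof (cases "s = 0")
  case False
  have "s ^ g = s ^ (j + Suc (g - Suc j))" using assms by simp
  then have "c + e * s ^ g = c + s ^ j * (e * s ^ (g - Suc j) * s)"
    by (simp only: power_add power_Suc mult_ac)
  then have "(c + e * s ^ g) div s ^ j = (c + s ^ j * (e * s ^ (g - Suc j) * s)) div s ^ j"
    by (simp only:)
  also have "\<dots> = c div s ^ j + (e * s ^ (g - Suc j)) * s"
    using False by simp
  finally show ?thesis by simp
qed (use assms in \<open>cases j; cases g; simp\<close>)

lemma index_add: "j \<le> g \<Longrightarrow> index b s m f w (c + e * s ^ g) j = index b s m f w c j"
  by (induction j) (auto simp: digit_add)

lemma weight_add: "j \<le> g \<Longrightarrow> weight b s h w (c + e * s ^ g) j = weight b s h w c j"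
  by (induction j) (auto simp: digit_add)

lemma sum_digit:
  fixes F :: "nat \<Rightarrow> 'a::comm_monoid_add"
  shows "(\<Sum>c<s ^ Suc g. F c) = (\<Sum>e<s. \<Sum>c<s ^ g. F (c + e * s ^ g))"
proof -
  have shift: "sum F {e * s ^ g..<e * s ^ g + s ^ g} = (\<Sum>c<s ^ g. F (c + e * s ^ g))" for e
    using sum.shift_bounds_nat_ivl[of F 0 "e * s ^ g" "s ^ g"]
    by (simp add: atLeast0LessThan add.commute)
  have "(\<Sum>c<s ^ Suc g. F c) = (\<Sum>e<s. sum F {e * s ^ g..<e * s ^ g + s ^ g})"
    by (simp add: sum.nat_group)
  also have "\<dots> = (\<Sum>e<s. \<Sum>c<s ^ g. F (c + e * s ^ g))"
    by (simp only: shift)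
  finally show ?thesis .
qed

text \<open>The mixed-product rule for Kronecker products, in scalar form. Table entries stay below
  \<open>m\<close>, so two indices agree exactly if they agree in every block; splitting off the top
  digits of \<open>c\<close> and \<open>c'\<close> then lets the distributive law factor the double
  sum.\<close>

lemma sum_index_weight:
  assumes f: "\<And>x e. f x e < m" "\<And>y e. f' y e < m"
  shows "(\<Sum>c<s ^ g. \<Sum>c'<s ^ g. if index b s m f w c g = index b s m f' w' c' g
            then weight b s h w c g * weight b s h' w' c' g else 0) =
    (\<Prod>j<g. \<Sum>e<s. \<Sum>e'<s. if f (block_code w (j * b) b) e = f' (block_code w' (j * b) b) e'
       then h (block_code w (j * b) b) e * h' (block_code w' (j * b) b) e' else 0)"
proof (induction g)
  case (Suc g)
  define X where "X = block_code w (g * b) b"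
  define Y where "Y = block_code w' (g * b) b"
  define I where "I c = index b s m f w c g" for c
  define I' where "I' c = index b s m f' w' c g" for c
  define W where "W c = weight b s h w c g" for c
  define W' where "W' c = weight b s h' w' c g" for c
  have dig: "(c + e * s ^ g) div s ^ g mod s = e" if "c < s ^ g" "e < s" for c e
    using that by simp
  have add: "I (c + e * s ^ g) = I c" "I' (c + e * s ^ g) = I' c"
    "W (c + e * s ^ g) = W c" "W' (c + e * s ^ g) = W' c" for c e
    by (simp_all add: I_def I'_def W_def W'_def index_add weight_add)
  have eq: "i * m + f X e = i' * m + f' Y e' \<longleftrightarrow> i = i' \<and> f X e = f' Y e'" for i i' e e'
  proof
    assume *: "i * m + f X e = i' * m + f' Y e'"
    have "(i * m + f X e) div m = i" "(i' * m + f' Y e') div m = i'"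
      using f(1)[of X e] f(2)[of Y e'] by auto
    with * show "i = i' \<and> f X e = f' Y e'" by auto
  qed auto
  have "(\<Sum>c<s ^ Suc g. \<Sum>c'<s ^ Suc g. if index b s m f w c (Suc g) = index b s m f' w' c' (Suc g)
            then weight b s h w c (Suc g) * weight b s h' w' c' (Suc g) else 0) =
     (\<Sum>e<s. \<Sum>c<s ^ g. \<Sum>e'<s. \<Sum>c'<s ^ g. if I c = I' c' \<and> f X e = f' Y e'
            then (W c * h X e) * (W' c' * h' Y e') else 0)"
    unfolding sum_digit
    by (intro sum.cong refl)
       (simp add: dig add X_def[symmetric] Y_def[symmetric] eq
         I_def[symmetric] I'_def[symmetric] W_def[symmetric] W'_def[symmetric] del: div_mult_self1 div_mult_self3)
  also have "\<dots> = (\<Sum>e<s. \<Sum>e'<s. \<Sum>c<s ^ g. \<Sum>c'<s ^ g. if I c = I' c' \<and> f X e = f' Y e'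
            then (W c * h X e) * (W' c' * h' Y e') else 0)"
    by (intro sum.cong[OF refl] sum.swap)
  also have "\<dots> = (\<Sum>e<s. \<Sum>e'<s. (\<Sum>c<s ^ g. \<Sum>c'<s ^ g. if I c = I' c' then W c * W' c' else 0) *
       (if f X e = f' Y e' then h X e * h' Y e' else 0))"
    unfolding sum_distrib_right by (intro sum.cong refl) auto
  also have "\<dots> = (\<Sum>c<s ^ g. \<Sum>c'<s ^ g. if I c = I' c' then W c * W' c' else 0) *
      (\<Sum>e<s. \<Sum>e'<s. if f X e = f' Y e' then h X e * h' Y e' else 0)"
    by (simp only: sum_distrib_left)
  finally show ?case
    using Suc.IH unfolding I_def I'_def W_def W'_def X_def Y_def by (simp only: prod.lessThan_Suc)
qed simp

section \<open>From choices of terms to orthogonal pairs\<close>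

definition coords :: "nat \<Rightarrow> int list \<Rightarrow> nat \<Rightarrow> nat" where
  "coords d u q = (if q < d then nat (u ! q) else 0)"

lemma coords_less:
  assumes "length u = d" "set u \<subseteq> {0, 1}"
  shows "coords d u q < 2"
  using subsetD[OF assms(2) nth_mem[of q u]] assms(1) by (auto simp: coords_def)

text \<open>The zeros with which \<open>coords\<close> continues a vector contribute factors 1, so
  the last block may run past \<open>d\<close>. A sum of nonnegative products vanishes only if every
  product does.\<close>

lemma prod_coords:
  assumes "length u = d" "set u \<subseteq> {0, 1}" "length v = d" "set v \<subseteq> {0, 1}" "d \<le> B"
  shows "(\<Prod>q<B. 1 - int (coords d u q) * int (coords d v q)) = (if inner_prod d u v = 0 then 1 else 0)"
proof -
  have u: "u ! q = 0 \<or> u ! q = 1" "v ! q = 0 \<or> v ! q = 1" if "q < d" for q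
    using subsetD[OF assms(2) nth_mem[of q u]] subsetD[OF assms(4) nth_mem[of q v]] assms(1,3) that
    by auto
  have "1 - int (coords d u q) * int (coords d v q) = (if q < d \<and> u ! q * v ! q \<noteq> 0 then 0 else 1)" for q
    using u[of q] by (cases "q < d") (auto simp: coords_def)
  then have "(\<Prod>q<B. 1 - int (coords d u q) * int (coords d v q)) =
      (\<Prod>q<d. if u ! q * v ! q = 0 then 1 else 0)"
    using assms(5) by (intro prod.mono_neutral_cong_right) auto
  also have "\<dots> = (if \<forall>q\<in>{..<d}. u ! q * v ! q = 0 then 1 else 0)"
    by (auto intro: prod.neutral)
  also have "(\<forall>q\<in>{..<d}. u ! q * v ! q = 0) \<longleftrightarrow> inner_prod d u v = 0"
    unfolding inner_prod_def using u
    by (subst sum_nonneg_eq_0_iff) (fastforce)+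
  finally show ?thesis .
qed

lemma count_OV_eq_sum:
  "int (count_OV n d us vs) = (\<Sum>i<n. \<Sum>j<n. if inner_prod d (us ! i) (vs ! j) = 0 then 1 else 0)"
proof -
  have "(\<Sum>i<n. \<Sum>j<n. if inner_prod d (us ! i) (vs ! j) = 0 then 1 else (0::int)) =
      (\<Sum>(i, j)\<in>{..<n} \<times> {..<n}. if inner_prod d (us ! i) (vs ! j) = 0 then 1 else 0)"
    by (simp add: sum.cartesian_product)
  also have "\<dots> = (\<Sum>(i, j)\<in>{(i, j). i < n \<and> j < n \<and> inner_prod d (us ! i) (vs ! j) = 0}. 1)"
    by (intro sum.mono_neutral_cong_right) (auto split: if_splits)
  finally show ?thesis by (simp add: count_OV_def)
qed

text \<open>With \<open>K = s ^ g\<close> this is entry \<open>q\<close> of the row belonging to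
  \<open>w\<close> in the Kronecker power of the left factor; smaller \<open>K\<close> describe the
  contribution while the loop over the choices is still running.\<close>

definition bucket :: "nat \<Rightarrow> nat \<Rightarrow> nat \<Rightarrow> (nat \<Rightarrow> nat \<Rightarrow> nat) \<Rightarrow> (nat \<Rightarrow> nat \<Rightarrow> int) \<Rightarrow> nat \<Rightarrow>
    (nat \<Rightarrow> nat) \<Rightarrow> nat \<Rightarrow> nat \<Rightarrow> int" where
  "bucket b s m f h g w K q = (\<Sum>c<K. if index b s m f w c g = q then weight b s h w c g else 0)"

text \<open>After the sums are swapped, the inner sum over \<open>i\<close> depends on
  \<open>j\<close> only through a bucket number. It can be stored once for all \<open>j\<close>,
  which replaces the pairs of vectors by two separate passes.\<close>

lemma count_OV_eq_buckets:
  assumes us: "zero_one_vectors n d us" and vs: "zero_one_vectors n d vs"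
    and f: "\<And>x e. f x e < m" "\<And>y e. f' y e < m"
    and tab: "\<And>x y. x < 2 ^ b \<Longrightarrow> y < 2 ^ b \<Longrightarrow>
      disj b x y = (\<Sum>e<s. \<Sum>e'<s. if f x e = f' y e' then h x e * h' y e' else 0)"
    and "d \<le> g * b"
  shows "int (count_OV n d us vs) = (\<Sum>j<n. \<Sum>c<s ^ g.
     (\<Sum>i<n. bucket b s m f h g (coords d (us ! i)) (s ^ g) (index b s m f' (coords d (vs ! j)) c g)) *
     weight b s h' (coords d (vs ! j)) c g)"
proof -
  let ?w = "\<lambda>i. coords d (us ! i)"
  let ?w' = "\<lambda>j. coords d (vs ! j)"
  have "(\<Sum>c<s ^ g. \<Sum>c'<s ^ g. if index b s m f (?w i) c g = index b s m f' (?w' j) c' g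
            then weight b s h (?w i) c g * weight b s h' (?w' j) c' g else 0) =
        (if inner_prod d (us ! i) (vs ! j) = 0 then 1 else 0)" if "i < n" "j < n" for i j
  proof -
    have len: "length (us ! i) = d" "set (us ! i) \<subseteq> {0, 1}" "length (vs ! j) = d" "set (vs ! j) \<subseteq> {0, 1}"
      using us vs that by (auto simp: zero_one_vectors_def)
    have w: "?w i q < 2" "?w' j q < 2" for q
      using coords_less len by metis+
    have "(\<Sum>c<s ^ g. \<Sum>c'<s ^ g. if index b s m f (?w i) c g = index b s m f' (?w' j) c' g
            then weight b s h (?w i) c g * weight b s h' (?w' j) c' g else 0) =
        (\<Prod>p<g. disj b (block_code (?w i) (p * b) b) (block_code (?w' j) (p * b) b))"
      by (simp add: sum_index_weight f tab block_code_less w)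
    also have "\<dots> = (\<Prod>p<g. \<Prod>q<b. 1 - int (?w i (p * b + q)) * int (?w' j (p * b + q)))"
      by (simp add: disj_block_code w)
    also have "\<dots> = (\<Prod>p<g. \<Prod>q = p * b..<p * b + b. 1 - int (?w i q) * int (?w' j q))"
    proof (rule prod.cong[OF refl])
      fix p
      show "(\<Prod>q<b. 1 - int (?w i (p * b + q)) * int (?w' j (p * b + q))) =
          (\<Prod>q = p * b..<p * b + b. 1 - int (?w i q) * int (?w' j q))"
        using prod.shift_bounds_nat_ivl[of "\<lambda>q. 1 - int (?w i q) * int (?w' j q)" 0 "p * b" b]
        by (simp add: atLeast0LessThan add.commute)
    qed
    also have "\<dots> = (\<Prod>q<g * b. 1 - int (?w i q) * int (?w' j q))"
      by (rule prod.nat_group)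
    also have "\<dots> = (if inner_prod d (us ! i) (vs ! j) = 0 then 1 else 0)"
      using prod_coords[OF len \<open>d \<le> g * b\<close>] .
    finally show ?thesis .
  qed
  then have "int (count_OV n d us vs) = (\<Sum>i<n. \<Sum>j<n. \<Sum>c<s ^ g. \<Sum>c'<s ^ g.
      if index b s m f (?w i) c g = index b s m f' (?w' j) c' g
      then weight b s h (?w i) c g * weight b s h' (?w' j) c' g else 0)"
    by (simp add: count_OV_eq_sum)
  also have "\<dots> = (\<Sum>j<n. \<Sum>i<n. \<Sum>c<s ^ g. \<Sum>c'<s ^ g.
      if index b s m f (?w i) c g = index b s m f' (?w' j) c' g
      then weight b s h (?w i) c g * weight b s h' (?w' j) c' g else 0)"
    by (rule sum.swap)
  also have "\<dots> = (\<Sum>j<n. \<Sum>i<n. \<Sum>c'<s ^ g. \<Sum>c<s ^ g.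
      if index b s m f (?w i) c g = index b s m f' (?w' j) c' g
      then weight b s h (?w i) c g * weight b s h' (?w' j) c' g else 0)"
    by (intro sum.cong[OF refl] sum.swap)
  also have "\<dots> = (\<Sum>j<n. \<Sum>c'<s ^ g. \<Sum>i<n. \<Sum>c<s ^ g.
      if index b s m f (?w i) c g = index b s m f' (?w' j) c' g
      then weight b s h (?w i) c g * weight b s h' (?w' j) c' g else 0)"
    by (intro sum.cong[OF refl] sum.swap)
  also have "\<dots> = (\<Sum>j<n. \<Sum>c<s ^ g.
     (\<Sum>i<n. bucket b s m f h g (?w i) (s ^ g) (index b s m f' (?w' j) c g)) *
     weight b s h' (?w' j) c g)"
    unfolding bucket_def sum_distrib_right by (intro sum.cong refl) auto
  finally show ?thesis .
qed

section \<open>Bounded execution\<close>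

lemma bits_le:
  assumes "\<bar>z\<bar> < 2 ^ w"
  shows "bits z \<le> w + 1"
proof -
  have "nat \<bar>z\<bar> < 2 ^ w" using assms by (simp add: nat_less_iff)
  then show ?thesis unfolding bits_def by (simp add: floorlog_leI)
qed

definition small :: "nat \<Rightarrow> int \<Rightarrow> bool" where
  "small w z \<longleftrightarrow> \<bar>z\<bar> < 2 ^ w"

lemma small_of_nat: "a < 2 ^ w \<Longrightarrow> small w (int a)"
  by (simp add: small_def)

text \<open>Every step is charged \<open>2 * w + 2\<close>, the most that two operands below
  \<open>2 ^ w\<close> in absolute value can cost. Logarithmic cost thus reduces to counting steps
  and bounding operands.\<close>

definition runs :: "nat \<Rightarrow> com \<Rightarrow> nat \<Rightarrow> (reg \<Rightarrow> int) \<Rightarrow> (int \<Rightarrow> int) \<Rightarrow>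
    ((reg \<Rightarrow> int) \<Rightarrow> (int \<Rightarrow> int) \<Rightarrow> bool) \<Rightarrow> bool" where
  "runs w c N r m Q \<longleftrightarrow> (\<exists>t r' m'. exec c (r, m) t (r', m') \<and> t \<le> N * (2 * w + 2) \<and> Q r' m')"

lemma runs_mono:
  assumes "runs w c N r m Q" "N \<le> N'" "\<And>r' m'. Q r' m' \<Longrightarrow> Q' r' m'"
  shows "runs w c N' r m Q'"
proof -
  obtain t r' m' where "exec c (r, m) t (r', m')" "t \<le> N * (2 * w + 2)" "Q r' m'"
    using assms(1) unfolding runs_def by blast
  moreover have "N * (2 * w + 2) \<le> N' * (2 * w + 2)" using assms(2) by (rule mult_le_mono1)
  ultimately show ?thesis unfolding runs_def using assms(3) order_trans by blast
qed

lemma bits_add_le: "small w y \<Longrightarrow> small w z \<Longrightarrow> bits y + bits z \<le> 2 * w + 2"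
  using bits_le[of y w] bits_le[of z w] by (simp add: small_def)

lemma one_step_le: "t \<le> 2 * w + 2 \<Longrightarrow> 1 \<le> N \<Longrightarrow> t \<le> N * (2 * w + 2)" for t w N :: nat
  using mult_le_mono1[of 1 N "2 * w + 2"] unfolding nat_mult_1 by (meson order_trans)

lemma runs_Const: "small w z \<Longrightarrow> 1 \<le> N \<Longrightarrow> Q (r(x := z)) m \<Longrightarrow> runs w (Const x z) N r m Q"
  unfolding runs_def using exec_Const[of x z r m] one_step_le[of "bits z" w N] bits_le[of z w]
  by (fastforce simp: small_def)

lemma runs_Arith:
  "small w (r y) \<Longrightarrow> small w (r z) \<Longrightarrow> 1 \<le> N \<Longrightarrow> Q (r(x := arith_val f (r y) (r z))) m \<Longrightarrow>
   runs w (Arith f x y z) N r m Q"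
  unfolding runs_def using exec_Arith one_step_le bits_add_le by blast

lemma runs_Load:
  "small w (r y) \<Longrightarrow> small w (m (r y)) \<Longrightarrow> 1 \<le> N \<Longrightarrow> Q (r(x := m (r y))) m \<Longrightarrow>
   runs w (Load x y) N r m Q"
  unfolding runs_def using exec_Load one_step_le bits_add_le by blast

lemma runs_Store:
  "small w (r x) \<Longrightarrow> small w (r y) \<Longrightarrow> 1 \<le> N \<Longrightarrow> Q r (m(r x := r y)) \<Longrightarrow>
   runs w (Store x y) N r m Q"
  unfolding runs_def using exec_Store one_step_le bits_add_le by blast

lemma runs_Seq:
  assumes "runs w c1 N1 r m R" "N1 \<le> N" "\<And>r' m'. R r' m' \<Longrightarrow> runs w c2 (N - N1) r' m' Q"
  shows "runs w (Seq c1 c2) N r m Q"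
proof -
  obtain t1 r1 m1 where 1: "exec c1 (r, m) t1 (r1, m1)" "t1 \<le> N1 * (2 * w + 2)" "R r1 m1"
    using assms(1) unfolding runs_def by blast
  obtain t2 r2 m2 where 2: "exec c2 (r1, m1) t2 (r2, m2)" "t2 \<le> (N - N1) * (2 * w + 2)" "Q r2 m2"
    using assms(3)[OF 1(3)] unfolding runs_def by blast
  have "t1 + t2 \<le> N1 * (2 * w + 2) + (N - N1) * (2 * w + 2)" using 1 2 by simp
  also have "\<dots> = N * (2 * w + 2)" using assms(2) by (metis add_mult_distrib le_add_diff_inverse)
  finally show ?thesis unfolding runs_def using exec_Seq[OF 1(1) 2(1)] 2(3) by blast
qed

lemma runs_Cond:
  assumes "small w (r x)" "small w (r y)" "1 \<le> N"
    "compare_val p (r x) (r y) \<Longrightarrow> runs w c1 (N - 1) r m Q"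
    "\<not> compare_val p (r x) (r y) \<Longrightarrow> runs w c2 (N - 1) r m Q"
  shows "runs w (Cond p x y c1 c2) N r m Q"
proof -
  have *: "bits (r x) + bits (r y) + t \<le> N * (2 * w + 2)" if "t \<le> (N - 1) * (2 * w + 2)" for t
    using bits_add_le[OF assms(1,2)] that assms(3) by (cases N) auto
  show ?thesis
    using assms(4,5) * exec_Cond_True[of p r x y c1 m _ _ c2] exec_Cond_False[of p r x y c2 m _ _ c1]
    unfolding runs_def by (cases "compare_val p (r x) (r y)") blast+
qed

fun writes :: "com \<Rightarrow> reg set" where
  "writes (Const x z) = {x}"
| "writes (Arith f x y z) = {x}"
| "writes (Load x y) = {x}"
| "writes (Store x y) = {}"
| "writes (Seq c1 c2) = writes c1 \<union> writes c2"
| "writes (Cond p x y c1 c2) = writes c1 \<union> writes c2"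
| "writes (While p x y c) = writes c"

lemma exec_frame: "exec c s t s' \<Longrightarrow> x \<notin> writes c \<Longrightarrow> fst s' x = fst s x"
  by (induction rule: exec.induct) auto

lemma runs_frame:
  assumes "runs w c N r m Q"
  shows "runs w c N r m (\<lambda>r' m'. Q r' m' \<and> (\<forall>x. x \<notin> writes c \<longrightarrow> r' x = r x))"
  using assms exec_frame[of c "(r, m)"] unfolding runs_def by fastforce

text \<open>The invariant is indexed by the number of finished rounds, and exactly \<open>K\<close>
  rounds are made. Unchanged registers come from the frame rule, so invariants need to mention only
  what the body writes. The additional steps pay for the \<open>K + 1\<close> tests.\<close>

lemma runs_While:
  assumes "I 0 r m"
    and step: "\<And>k r' m'. k < K \<Longrightarrow> I k r' m' \<Longrightarrow> (\<And>x. x \<notin> writes c \<Longrightarrow> r' x = r x) \<Longrightarrow>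
       small w (r' x) \<and> small w (r' y) \<and> compare_val p (r' x) (r' y) \<and> runs w c B r' m' (I (Suc k))"
    and stop: "\<And>r' m'. I K r' m' \<Longrightarrow> (\<And>x. x \<notin> writes c \<Longrightarrow> r' x = r x) \<Longrightarrow>
       small w (r' x) \<and> small w (r' y) \<and> \<not> compare_val p (r' x) (r' y)"
  shows "runs w (While p x y c) (K * (B + 1) + 1) r m (I K)"
proof -
  have "runs w (While p x y c) ((K - k) * (B + 1) + 1) r' m' (I K)"
    if "k \<le> K" "I k r' m'" "\<And>x. x \<notin> writes c \<Longrightarrow> r' x = r x" for k r' m'
    using that
  proof (induction k arbitrary: r' m' rule: inc_induct)
    case base
    with stop[of r' m'] have "exec (While p x y c) (r', m') (bits (r' x) + bits (r' y)) (r', m')"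
      "bits (r' x) + bits (r' y) \<le> 2 * w + 2"
      using bits_add_le[of w "r' x" "r' y"] by (auto intro: exec_While_False)
    then show ?case using base unfolding runs_def by auto
  next
    case (step k)
    note * = assms(2)[OF step.hyps(2) step.prems]
    have "runs w c B r' m' (\<lambda>r'' m''. I (Suc k) r'' m'' \<and> (\<forall>x. x \<notin> writes c \<longrightarrow> r'' x = r' x))"
      using * by (intro runs_frame) blast
    then obtain t1 r1 m1 where 1: "exec c (r', m') t1 (r1, m1)" "t1 \<le> B * (2 * w + 2)" "I (Suc k) r1 m1"
      "\<And>x. x \<notin> writes c \<Longrightarrow> r1 x = r x"
      unfolding runs_def using step.prems(2) by fastforce
    obtain t2 r2 m2 where 2: "exec (While p x y c) (r1, m1) t2 (r2, m2)"
      "t2 \<le> ((K - Suc k) * (B + 1) + 1) * (2 * w + 2)" "I K r2 m2"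
      using step.IH[OF 1(3,4)] unfolding runs_def by blast
    have "bits (r' x) + bits (r' y) \<le> 2 * w + 2" using * by (intro bits_add_le) auto
    then have "bits (r' x) + bits (r' y) + t1 + t2 \<le>
        (2 * w + 2) + B * (2 * w + 2) + ((K - Suc k) * (B + 1) + 1) * (2 * w + 2)"
      using 1(2) 2(2) by linarith
    also have "\<dots> = ((Suc (K - Suc k)) * (B + 1) + 1) * (2 * w + 2)" by (simp add: algebra_simps)
    also have "Suc (K - Suc k) = K - k" using step.hyps by simp
    finally show ?case
      unfolding runs_def using exec_While_True[where p = p and x = x and y = y, OF _ 1(1) 2(1)] * 2(3) by blast
  qed
  from this[of 0 r m] show ?thesis using assms(1) by simp
qed

text \<open>A table is unrolled into nested conditionals and so needs no memory; \<open>t\<close> is a scratch register.\<close>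

fun lookup :: "reg \<Rightarrow> reg \<Rightarrow> reg \<Rightarrow> (nat \<Rightarrow> int) \<Rightarrow> nat \<Rightarrow> com" where
  "lookup y t x F 0 = Seq (Const t 0) (Const y 0)"
| "lookup y t x F (Suc k) = Seq (Const t (int k)) (Cond EQ x t (Const y (F k)) (lookup y t x F k))"

text \<open>The empty table also sets both registers, which makes the set independent of
  \<open>N\<close>.\<close>

lemma writes_lookup [simp]: "writes (lookup y t x F N) = {y, t}"
  by (induction N) auto

lemma runs_lookup:
  assumes "r x = int a" "a < N" "small w (int a)" "small w (int N)" "\<And>k. k < N \<Longrightarrow> small w (F k)" "distinct [x, y, t]"
  shows "runs w (lookup y t x F N) (2 * N + 2) r m (\<lambda>r' m'. m' = m \<and> r' y = F a)"
  using assms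
proof (induction N arbitrary: r m)
  case (Suc N)
  have sN: "small w (int N)" using Suc.prems(4) unfolding small_def by linarith
  show ?case
    unfolding lookup.simps
  proof (rule runs_Seq[of _ _ 1 _ _ "\<lambda>r' m'. m' = m \<and> r' = r(t := int N)"], goal_cases)
    case (3 r' m')
    show ?case
    proof (rule runs_Cond, goal_cases)
      case 5
      with 3 Suc.prems have "a < N" by auto
      then have "runs w (lookup y t x F N) (2 * N + 2) r' m' (\<lambda>r' m''. m'' = m' \<and> r' y = F a)"
        using Suc.prems 3 sN by (intro Suc.IH) auto
      then show ?case by (rule runs_mono) (use 3 in auto)
    qed (use 3 Suc.prems sN in \<open>auto intro!: runs_Const\<close>)
  qed (use sN in \<open>auto intro!: runs_Const\<close>)
qed simp

lemmas runs_step = runs_Seq[OF runs_frame]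

lemma runs_Seq_Const:
  "small w z \<Longrightarrow> 1 \<le> N \<Longrightarrow> runs w c (N - 1) (r(x := z)) m Q \<Longrightarrow> runs w (Seq (Const x z) c) N r m Q"
  by (rule runs_Seq[of _ _ 1 _ _ "\<lambda>r' m'. r' = r(x := z) \<and> m' = m"]) (auto intro: runs_Const)

lemma runs_Seq_Arith:
  "small w (r y) \<Longrightarrow> small w (r z) \<Longrightarrow> 1 \<le> N \<Longrightarrow>
   runs w c (N - 1) (r(x := arith_val f (r y) (r z))) m Q \<Longrightarrow> runs w (Seq (Arith f x y z) c) N r m Q"
  by (rule runs_Seq[of _ _ 1 _ _ "\<lambda>r' m'. r' = r(x := arith_val f (r y) (r z)) \<and> m' = m"])
    (auto intro: runs_Arith)

lemma runs_Seq_Load: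
  "small w (r y) \<Longrightarrow> small w (m (r y)) \<Longrightarrow> 1 \<le> N \<Longrightarrow>
   runs w c (N - 1) (r(x := m (r y))) m Q \<Longrightarrow> runs w (Seq (Load x y) c) N r m Q"
  by (rule runs_Seq[of _ _ 1 _ _ "\<lambda>r' m'. r' = r(x := m (r y)) \<and> m' = m"]) (auto intro: runs_Load)

lemmas straight_line =
  runs_Seq_Const runs_Seq_Arith runs_Seq_Load runs_Const runs_Arith runs_Load runs_Store

section \<open>The program\<close>

notation Seq (infixr ";;" 60)

text \<open>
  Registers: 0 \<open>n\<close>, 1 \<open>d\<close>, 2 the constant 1, 3 \<open>b\<close>, 4 \<open>s\<close>, 5 \<open>m\<close>, 6 \<open>g\<close>, 7 \<open>s ^ g\<close>, 8 block number,
  9 address of the current vector, 10 its number, 11 choice \<open>c\<close> of a term in every block,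
  12 bucket index, 13 weight, 14 remaining digits of \<open>c\<close>, 15 block code, 16 loop counter,
  17 coordinate, 18 and 19 scratch, 21 running total; 22 is never written and stays 0.
\<close>

definition read_block :: com where
  "read_block =
     Const 15 0 ;; Const 16 0 ;; Arith MUL 17 8 3 ;;
     While LESS 16 3
       (Cond LESS 17 1 (Arith ADD 19 9 17 ;; Load 18 19) (Const 18 0) ;;
        Arith ADD 15 15 15 ;; Arith ADD 15 15 18 ;; Arith ADD 17 17 2 ;; Arith ADD 16 16 2)"

text \<open>There is neither a modulo nor a move instruction: the remainder comes from DIV, MUL and
  SUB, and copying means adding register 22. Both tables share the key block code times
  \<open>s\<close> plus digit, hence the size \<open>2 ^ b * s\<close>.\<close>

definition decode_step :: "nat \<Rightarrow> nat \<Rightarrow> (nat \<Rightarrow> nat \<Rightarrow> nat) \<Rightarrow> (nat \<Rightarrow> nat \<Rightarrow> int) \<Rightarrow> com" where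
  "decode_step b s f h =
     read_block ;;
     Arith DIV 19 14 4 ;; Arith MUL 18 19 4 ;; Arith SUB 18 14 18 ;; Arith ADD 14 19 22 ;;
     Arith MUL 15 15 4 ;; Arith ADD 15 15 18 ;;
     lookup 18 19 15 (\<lambda>y. int (f (y div s) (y mod s))) (2 ^ b * s) ;;
     Arith MUL 12 12 5 ;; Arith ADD 12 12 18 ;;
     lookup 18 19 15 (\<lambda>y. h (y div s) (y mod s)) (2 ^ b * s) ;;
     Arith MUL 13 13 18 ;; Arith ADD 8 8 2"

definition decode :: "nat \<Rightarrow> nat \<Rightarrow> (nat \<Rightarrow> nat \<Rightarrow> nat) \<Rightarrow> (nat \<Rightarrow> nat \<Rightarrow> int) \<Rightarrow> com" where
  "decode b s f h =
     Const 12 0 ;; Const 13 1 ;; Arith ADD 14 11 22 ;; Const 8 0 ;; While LESS 8 6 (decode_step b s f h)"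

text \<open>Register 9 is not reset here: a second run continues where the first one stopped, at the
  first of the v.\<close>

definition for_all_terms :: "nat \<Rightarrow> nat \<Rightarrow> (nat \<Rightarrow> nat \<Rightarrow> nat) \<Rightarrow> (nat \<Rightarrow> nat \<Rightarrow> int) \<Rightarrow> com \<Rightarrow> com" where
  "for_all_terms b s f h act =
     Const 10 0 ;;
     While LESS 10 0
       (Const 11 0 ;;
        While LESS 11 7 (decode b s f h ;; act ;; Arith ADD 11 11 2) ;;
        Arith ADD 9 9 1 ;; Arith ADD 10 10 2)"

text \<open>Bucket \<open>q\<close> is memory cell \<open>-1 - q\<close>: the negative cells are free of input and initially 0.\<close>

definition add_to_bucket :: com where
  "add_to_bucket =
     Const 18 (-1) ;; Arith SUB 18 18 12 ;; Load 19 18 ;; Arith ADD 19 19 13 ;; Store 18 19"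

definition add_bucket_to_total :: com where
  "add_bucket_to_total =
     Const 18 (-1) ;; Arith SUB 18 18 12 ;; Load 19 18 ;; Arith MUL 19 19 13 ;; Arith ADD 21 21 19"

definition prepare :: "nat \<Rightarrow> nat \<Rightarrow> nat \<Rightarrow> com" where
  "prepare b s m =
     Const 2 1 ;; Const 3 (int b) ;; Const 4 (int s) ;; Const 5 (int m) ;;
     Arith DIV 6 1 3 ;; Arith ADD 6 6 2 ;; Const 7 1 ;; Const 8 0 ;;
     While LESS 8 6 (Arith MUL 7 7 4 ;; Arith ADD 8 8 2)"

definition count_program :: "nat \<Rightarrow> nat \<Rightarrow> nat \<Rightarrow> (nat \<Rightarrow> nat \<Rightarrow> nat) \<Rightarrow> (nat \<Rightarrow> nat \<Rightarrow> int) \<Rightarrow>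
    (nat \<Rightarrow> nat \<Rightarrow> nat) \<Rightarrow> (nat \<Rightarrow> nat \<Rightarrow> int) \<Rightarrow> com" where
  "count_program b s m f h f' h' =
     prepare b s m ;; for_all_terms b s f h add_to_bucket ;;
     for_all_terms b s f' h' add_bucket_to_total ;; Arith ADD 0 21 22"

text \<open>One inequality for each kind of number in a run: addresses, coordinate numbers, table
  keys, choices, bucket indices, signed sums, counters. In \<open>total_less\<close> the summand 1
  and the odd exponent leave room for a single weight even if \<open>n\<close> or \<open>g\<close>
  is 0.\<close>

locale word_bound =
  fixes b s m g n d w M :: nat
  assumes pos: "b > 0" "s > 0" "m > 0" "M > 0"
    and d_le: "d \<le> g * b"
    and address_less: "2 * n * d + d < 2 ^ w"
    and coordinate_less: "(g + 1) * b < 2 ^ w"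
    and table_less: "2 ^ b * s < 2 ^ w"
    and terms_less: "s ^ g < 2 ^ w"
    and index_bound: "m ^ g * m < 2 ^ w"
    and total_less: "(n * s ^ g + 1)\<^sup>2 * M ^ (2 * g + 1) < 2 ^ w"
    and size_less: "n < 2 ^ w" "g < 2 ^ w"
begin

lemma small_le: "a \<le> c \<Longrightarrow> c < 2 ^ w \<Longrightarrow> small w (int a)"
  by (simp add: small_of_nat)

lemma small_consts: "small w (int b)" "small w (int s)" "small w (int m)" "small w (int d)"
  "small w (int n)" "small w (int g)" "small w 0" "small w 1" "small w (-1)"
  "small w (int (2 ^ b * s))" "small w (int (s ^ g))"
proof -
  have "d \<le> (g + 1) * b" using d_le by simp
  then show "small w (int d)" by (rule small_le[OF _ coordinate_less])
  show "small w (int b)" by (rule small_le[OF _ coordinate_less]) simp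
  show "small w (int s)" by (rule small_le[OF _ table_less]) simp
  show "small w (int m)" by (rule small_le[OF _ index_bound]) (simp add: pos Suc_le_eq)
  show "small w (int (2 ^ b * s))" "small w (int (s ^ g))" "small w (int n)" "small w (int g)"
    by (rule small_of_nat[OF table_less] small_of_nat[OF terms_less] small_of_nat[OF size_less(1)]
        small_of_nat[OF size_less(2)])+
  have "(g + 1) * b > 0" using pos by simp
  then have "(2::nat) ^ w > 1" using coordinate_less by linarith
  then have "int 1 < int (2 ^ w)" by (rule of_nat_less_iff[THEN iffD2])
  then have "(2::int) ^ w > 1" by (simp only: of_nat_1 of_nat_power of_nat_numeral)
  then show "small w 0" "small w 1" "small w (-1)" unfolding small_def by linarith+
qed

section \<open>Reading and decoding one vector\<close>

definition loaded :: "(reg \<Rightarrow> int) \<Rightarrow> bool" where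
  "loaded r \<longleftrightarrow> r 0 = int n \<and> r 1 = int d \<and> r 2 = 1 \<and> r 3 = int b \<and> r 4 = int s \<and> r 5 = int m \<and>
     r 6 = int g \<and> r 7 = int (s ^ g) \<and> r 22 = 0"

definition holds_vector :: "(int \<Rightarrow> int) \<Rightarrow> nat \<Rightarrow> (nat \<Rightarrow> nat) \<Rightarrow> bool" where
  "holds_vector mem p v \<longleftrightarrow> (\<forall>q<d. mem (int (p + q)) = int (v q)) \<and> (\<forall>q\<ge>d. v q = 0) \<and>
     (\<forall>q. v q < 2) \<and> p \<le> 2 * n * d"

lemma runs_read_block:
  assumes "loaded r" "r 8 = int j" "j < g" "r 9 = int p" "holds_vector mem p v"
  shows "runs w read_block (8 * b + 4) r mem (\<lambda>r' mem'. mem' = mem \<and> r' 15 = int (block_code v (j * b) b))"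
proof -
  let ?body = "Cond LESS 17 1 (Arith ADD 19 9 17 ;; Load 18 19) (Const 18 0) ;;
        Arith ADD 15 15 15 ;; Arith ADD 15 15 18 ;; Arith ADD 17 17 2 ;; Arith ADD 16 16 2"
  let ?I = "\<lambda>k r' mem'. mem' = mem \<and> r' 16 = int k \<and> r' 17 = int (j * b + k) \<and>
     r' 15 = int (block_code v (j * b) k)"
  note r = assms(1,2,4)[unfolded loaded_def]
  have v: "v q < 2" for q using assms(5) by (simp add: holds_vector_def)
  have jb: "j * b + k \<le> (g + 1) * b" if "k \<le> b" for k
  proof -
    have "j * b \<le> g * b" using assms(3) by (intro mult_le_mono1) simp
    then show ?thesis using that by (simp only: add_mult_distrib nat_mult_1)
  qed
  have loop: "runs w (While LESS 16 3 ?body) (b * (7 + 1) + 1) r0 mem (?I b)"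
    if r0: "?I 0 r0 mem" "\<And>x. x \<notin> {15, 16, 17} \<Longrightarrow> r0 x = r x" for r0
  proof (rule runs_While[where I = ?I])
    show "?I 0 r0 mem" by (rule r0)
  next
    fix k r' mem'
    assume k: "k < b" and I: "?I k r' mem'" and fr: "\<And>x. x \<notin> writes ?body \<Longrightarrow> r' x = r0 x"
    have r': "r' 1 = int d" "r' 2 = 1" "r' 3 = int b" "r' 9 = int p"
      using fr r0(2) r by auto
    have code_less: "2 * block_code v (j * b) k < 2 ^ b"
    proof -
      have "2 * block_code v (j * b) k < 2 ^ Suc k" using block_code_less[OF v] by simp
      also have "\<dots> \<le> 2 ^ b" using k by (intro power_increasing) auto
      finally show ?thesis .
    qed
    have "2 ^ b \<le> 2 ^ b * s" using pos by simp
    then have "block_code v (j * b) k \<le> 2 ^ b * s" "2 * block_code v (j * b) k \<le> 2 ^ b * s"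
      using code_less by linarith+
    then have sm: "small w (int (block_code v (j * b) k))" "small w (2 * int (block_code v (j * b) k))"
      using small_le[OF _ table_less, of "block_code v (j * b) k"]
        small_le[OF _ table_less, of "2 * block_code v (j * b) k"] by (simp_all only: of_nat_mult of_nat_numeral)
    have sk: "small w (int k)" "small w (int j * int b + int k)"
      using small_le[OF jb[of k] coordinate_less] small_le[OF _ coordinate_less, of k] k
      by (auto simp: trans_le_add1)
    have sv: "small w (int (v q))" for q
      using v[of q] small_consts(7,8) by (cases "v q"; simp)
    have step: "runs w (Cond LESS 17 1 (Arith ADD 19 9 17 ;; Load 18 19) (Const 18 0)) 3 r' mem'
       (\<lambda>r'' mem''. mem'' = mem' \<and> r'' 18 = int (v (j * b + k)))"
    proof (rule runs_Cond, goal_cases)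
      case 4
      then have "int (j * b + k) < int d" using I r' by simp
      then have q: "j * b + k < d" by (simp only: of_nat_less_iff)
      then have "p + (j * b + k) \<le> 2 * n * d + d" using assms(5) unfolding holds_vector_def by linarith
      then have "small w (int (p + (j * b + k)))" by (rule small_le[OF _ address_less])
      moreover have "small w (int p)"
        using assms(5) by (intro small_le[OF _ address_less]) (simp add: holds_vector_def)
      moreover have "mem (int (p + (j * b + k))) = int (v (j * b + k))"
        using q assms(5) unfolding holds_vector_def by blast
      ultimately show ?case using I r' sk sv[of "j * b + k"]
        by (intro straight_line) (auto simp: algebra_simps)
    next
      case 5
      then have "\<not> int (j * b + k) < int d" using I r' by simp
      then have "d \<le> j * b + k" by (simp only: of_nat_less_iff not_less)
      then have "v (j * b + k) = 0" using assms(5) by (simp add: holds_vector_def)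
      then show ?case using small_consts by (intro straight_line) auto
    qed (use I r' sk small_consts in auto)
    have "runs w ?body 7 r' mem' (?I (Suc k))"
    proof (rule runs_step[OF step], goal_cases)
      case (2 r1 m1)
      then have "r1 15 = r' 15" "r1 16 = r' 16" "r1 17 = r' 17" "r1 2 = 1" using r' by auto
      then show ?case using 2 I sm sk sv[of "j * b + k"] small_consts
        by (intro straight_line) auto
    qed simp
    then show "small w (r' 16) \<and> small w (r' 3) \<and> compare_val LESS (r' 16) (r' 3) \<and>
        runs w ?body 7 r' mem' (?I (Suc k))"
      using I r' sk small_consts k by auto
  next
    fix r' mem'
    assume I: "?I b r' mem'" and fr: "\<And>x. x \<notin> writes ?body \<Longrightarrow> r' x = r0 x"
    have "r' 3 = int b" using fr r0(2) r by auto
    then show "small w (r' 16) \<and> small w (r' 3) \<and> \<not> compare_val LESS (r' 16) (r' 3)"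
      using I small_consts by auto
  qed
  have "small w (int j)" using assms(3) by (intro small_le[OF _ size_less(2)]) simp
  then show ?thesis
    unfolding read_block_def
    using r small_consts by (intro straight_line runs_mono[OF loop]) auto
qed

end

lemma abs_weight_le:
  assumes "\<And>x e. \<bar>h x e\<bar> \<le> int M"
  shows "\<bar>weight b s h v c j\<bar> \<le> int (M ^ j)"
proof (induction j)
  case (Suc j)
  have "\<bar>weight b s h v c j\<bar> * \<bar>h (block_code v (j * b) b) (c div s ^ j mod s)\<bar> \<le> int (M ^ j) * int M"
    by (intro mult_mono Suc assms) auto
  then show ?case by (simp add: abs_mult mult.commute[of "int M"])
qed simp

lemma abs_bucket_le:
  assumes "\<And>x e. \<bar>h x e\<bar> \<le> int M"
  shows "\<bar>bucket b s m f h g v K q\<bar> \<le> int (K * M ^ g)"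
proof -
  have "\<bar>bucket b s m f h g v K q\<bar> \<le> (\<Sum>c<K. int (M ^ g))"
    unfolding bucket_def
    by (intro order_trans[OF sum_abs] sum_mono) (use abs_weight_le[of h M, OF assms] in auto)
  then show ?thesis by simp
qed

context word_bound
begin

text \<open>Weights, buckets and totals are sums of at most \<open>A\<close> products of at most
  \<open>k\<close> table entries; these two counts are all that has to be checked.\<close>

lemma small_weight_bound:
  assumes "\<bar>z\<bar> \<le> int A * int (M ^ k)" "A \<le> (n * s ^ g + 1)\<^sup>2" "k \<le> 2 * g + 1"
  shows "small w z"
proof -
  have "A * M ^ k \<le> (n * s ^ g + 1)\<^sup>2 * M ^ (2 * g + 1)"
    using assms pos by (intro mult_mono power_increasing) auto
  then have "A * M ^ k < 2 ^ w" using total_less by linarith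
  then have "int (A * M ^ k) < int (2 ^ w)" by (rule of_nat_less_iff[THEN iffD2])
  then show ?thesis using assms(1) unfolding small_def by simp
qed

text \<open>A constant of the program: it depends on the fixed tables only.\<close>

definition decode_step_time :: nat where
  "decode_step_time = 8 * b + 4 * (2 ^ b * s) + 18"

lemma runs_decode_step:
  assumes f: "\<And>x e. f x e < m" and h: "\<And>x e. \<bar>h x e\<bar> \<le> int M"
    and r: "loaded r" "r 8 = int j" "r 9 = int p" "r 14 = int (c div s ^ j)"
      "r 12 = int (index b s m f v c j)" "r 13 = weight b s h v c j"
    and j: "j < g" and c: "c < s ^ g" and v: "holds_vector mem p v"
  shows "runs w (decode_step b s f h) decode_step_time r mem (\<lambda>r' mem'. mem' = mem \<and>
     r' 8 = int (Suc j) \<and> r' 14 = int (c div s ^ Suc j) \<and>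
     r' 12 = int (index b s m f v c (Suc j)) \<and> r' 13 = weight b s h v c (Suc j))"
proof -
  let ?B = "block_code v (j * b) b"
  let ?C = "c div s ^ j"
  let ?N = "2 ^ b * s"
  note r' = r[unfolded loaded_def]
  have B: "?B < 2 ^ b" using v by (intro block_code_less) (auto simp: holds_vector_def)
  have e: "?C mod s < s" using pos by simp
  have code: "?B * s + ?C mod s < ?N"
  proof -
    have "?B * s + ?C mod s < Suc ?B * s" using e by simp
    also have "\<dots> \<le> ?N" using B by (intro mult_le_mono1) simp
    finally show ?thesis .
  qed
  have "?C \<le> c" by (rule div_le_dividend)
  then have sC: "small w (int k)" if "k \<le> ?C" for k
    using that c terms_less by (intro small_of_nat) linarith
  have sN: "small w (int k)" if "k \<le> ?N" for k
    by (rule small_le[OF that table_less])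
  have index_le: "index b s m f v c j < m ^ g"
    using index_less[where f = f, OF f, where b = b and s = s and w = v and c = c and j = j] power_increasing[of j g m] pos j by (simp add: less_le_trans)
  have sm: "small w (int k)" if "k \<le> m ^ g * m" for k by (rule small_le[OF that index_bound])
  have s1: "small w (int (index b s m f v c j))" "small w (int (index b s m f v c j) * int m)"
  proof -
    have i: "index b s m f v c j * m \<le> m ^ g * m" using index_le by (intro mult_le_mono1) simp
    moreover have "index b s m f v c j \<le> index b s m f v c j * m" using pos by simp
    ultimately have "index b s m f v c j \<le> m ^ g * m" by linarith
    then show "small w (int (index b s m f v c j))" by (rule sm)
    show "small w (int (index b s m f v c j) * int m)" using sm[OF i] by simp
  qed
  have sf: "small w (int (f x e))" for x e
    using f[of x e] small_le[OF _ index_bound, of "f x e"] pos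
    by (simp add: order_trans[OF less_imp_le])
  have sh: "small w (h x e)" for x e
    using h[of x e] by (intro small_weight_bound[of _ 1 1]) auto
  have sw: "small w (weight b s h v c j)"
    using abs_weight_le[where h = h, OF h, where b = b and s = s and v = v and c = c and j = j] j by (intro small_weight_bound[of _ 1 j]) auto
  have tab: "(?B * s + ?C mod s) div s = ?B" "(?B * s + ?C mod s) mod s = ?C mod s"
    using e by auto
  have C_eq: "int ?C - int ?C div int s * int s = int (?C mod s)"
    by (simp add: minus_div_mult_eq_mod zmod_int)
  have C_div: "int ?C div int s = int (c div (s * s ^ j))"
    by (metis div_mult2_eq mult.commute zdiv_int)
  have C_mul: "small w (int ?C div int s * int s)"
    using sC[of "?C div s * s"] by (simp add: zdiv_int)
  have C_div': "small w (int ?C div int s)"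
    using sC[of "?C div s"] by (simp add: zdiv_int)
  have "small w (int (?C mod s))" using sC by simp
  note small = sN sC[of ?C, simplified] s1 sf sh sw C_mul C_div' this small_consts small_consts[simplified]
  have sj: "small w (int j)" using j by (intro small_le[OF _ size_less(2)]) simp
  have B_mul: "small w (int ?B)" "small w (int ?B * int s)"
  proof -
    have "2 ^ b \<le> ?N" using pos by simp
    then have "?B \<le> ?N" using B by linarith
    then show "small w (int ?B)" by (rule sN)
    show "small w (int ?B * int s)" using sN[of "?B * s"] code by (metis add_leD1 less_imp_le of_nat_mult)
  qed
  have code_small: "small w (int ?B * int s + int (?C mod s))"
    using sN[OF less_imp_le[OF code]] by simp
  have code_int: "int ?B * int s + int (?C mod s) = int (?B * s + ?C mod s)" by simp
  show ?thesis
    unfolding decode_step_def decode_step_time_def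
  proof (rule runs_step[OF runs_read_block[OF r(1,2) j r(3) v]], goal_cases)
    case (2 r1 m1)
    have r1: "r1 2 = 1" "r1 4 = int s" "r1 5 = int m" "r1 8 = int j" "r1 12 = r 12" "r1 13 = r 13"
      "r1 14 = int ?C" "r1 22 = 0" "r1 15 = int ?B" "m1 = mem"
      using 2 r' by (auto simp: read_block_def)
    show ?case
    proof (intro straight_line, goal_cases)
      \<comment> \<open>Six arithmetic instructions leave three side conditions each; the next goal
        is the first table lookup.\<close>
      case 19
      show ?case
      proof (rule runs_step[OF runs_lookup[where a = "?B * s + ?C mod s"]], goal_cases)
        case (8 r2 m2)
        then have r2: "r2 2 = 1" "r2 5 = int m" "r2 8 = int j" "r2 12 = r 12" "r2 13 = r 13"
          "r2 14 = int (c div s ^ Suc j)" "r2 15 = int (?B * s + ?C mod s)"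
          "r2 18 = int (f ?B (?C mod s))" "m2 = mem"
          using r1 by (auto simp: C_eq[unfolded C_div] C_div tab)
        show ?case
        proof (intro straight_line, goal_cases)
          case 7
          show ?case
          proof (rule runs_step[OF runs_lookup[where a = "?B * s + ?C mod s"]], goal_cases)
            case (8 r3 m3)
            then have r3: "r3 2 = 1" "r3 8 = int j" "r3 13 = r 13"
              "r3 12 = r 12 * int m + int (f ?B (?C mod s))"
              "r3 14 = int (c div s ^ Suc j)" "r3 18 = h ?B (?C mod s)" "m3 = mem"
              using r2 by (auto simp: tab)
            show ?case
              by (intro straight_line) (auto simp: r3 r' small sj)
          qed (auto simp: r2 code small code_small)
        qed (auto simp: r2 r' small)
      qed (auto simp: r1 C_eq code code_int small sN[OF less_imp_le[OF code]] simp del: of_nat_add of_nat_mult)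
    qed (auto simp: r1 C_eq small B_mul)
  qed simp
qed

definition decode_time :: nat where
  "decode_time = g * (decode_step_time + 1) + 5"

lemma runs_decode:
  assumes f: "\<And>x e. f x e < m" and h: "\<And>x e. \<bar>h x e\<bar> \<le> int M"
    and r: "loaded r" "r 9 = int p" "r 11 = int c"
    and c: "c < s ^ g" and v: "holds_vector mem p v"
  shows "runs w (decode b s f h) decode_time r mem (\<lambda>r' mem'. mem' = mem \<and>
     r' 12 = int (index b s m f v c g) \<and> r' 13 = weight b s h v c g)"
proof -
  let ?I = "\<lambda>j r' mem'. mem' = mem \<and> r' 8 = int j \<and> r' 14 = int (c div s ^ j) \<and>
     r' 12 = int (index b s m f v c j) \<and> r' 13 = weight b s h v c j"
  have loop: "runs w (While LESS 8 6 (decode_step b s f h)) (g * (decode_step_time + 1) + 1) r0 mem (?I g)"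
    if r0: "?I 0 r0 mem" "\<And>x. x \<notin> {8, 12, 13, 14} \<Longrightarrow> r0 x = r x" for r0
  proof (rule runs_While[where I = ?I])
    fix j r' mem'
    assume j: "j < g" and I: "?I j r' mem'"
      and fr: "\<And>x. x \<notin> writes (decode_step b s f h) \<Longrightarrow> r' x = r0 x"
    have "loaded r'" "r' 9 = int p"
      using fr r0(2) r by (auto simp: loaded_def decode_step_def read_block_def)
    have mem': "mem' = mem" using I by simp
    have "runs w (decode_step b s f h) decode_step_time r' mem' (?I (Suc j))"
      unfolding mem' by (rule runs_decode_step[OF f h])
        (use I j c v \<open>loaded r'\<close> \<open>r' 9 = int p\<close> in auto)
    moreover have "small w (int j)" using j by (intro small_le[OF _ size_less(2)]) simp
    ultimately show "small w (r' 8) \<and> small w (r' 6) \<and> compare_val LESS (r' 8) (r' 6) \<and>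
        runs w (decode_step b s f h) decode_step_time r' mem' (?I (Suc j))"
      using \<open>loaded r'\<close> I j small_consts by (auto simp: loaded_def)
  next
    fix r' mem'
    assume I: "?I g r' mem'" and fr: "\<And>x. x \<notin> writes (decode_step b s f h) \<Longrightarrow> r' x = r0 x"
    have "r' 6 = int g"
      using fr r0(2) r by (auto simp: loaded_def decode_step_def read_block_def)
    then show "small w (r' 8) \<and> small w (r' 6) \<and> \<not> compare_val LESS (r' 8) (r' 6)"
      using I small_consts by auto
  qed (use r0 in auto)
  have "small w (int c)" using c by (intro small_le[OF _ terms_less]) simp
  then show ?thesis
    unfolding decode_def decode_time_def
    using r small_consts
    by (intro straight_line runs_mono[OF loop]) (auto simp: loaded_def)
qed

end

section \<open>The loop over all vectors and choices\<close>

lemma writes_decode: "writes (decode b s f h) = {8, 12, 13, 14, 15, 16, 17, 18, 19}"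
  by (auto simp: decode_def decode_step_def read_block_def)

context word_bound
begin

lemma loaded_cong:
  assumes "loaded r" "\<And>x. x \<le> 7 \<or> x = 22 \<Longrightarrow> r' x = r x"
  shows "loaded r'"
  using assms unfolding loaded_def by auto

definition terms_time :: "nat \<Rightarrow> nat" where
  "terms_time A = s ^ g * (decode_time + A + 2) + 1"

text \<open>Both passes are instances. \<open>P\<close> speaks of the memory and the running total
  after \<open>i\<close> complete vectors and \<open>c\<close> choices for the next one;
  \<open>wrap\<close> says that a finished vector is the same as the next one not yet begun.\<close>

lemma runs_for_all_terms:
  fixes P :: "nat \<Rightarrow> nat \<Rightarrow> (int \<Rightarrow> int) \<Rightarrow> int \<Rightarrow> bool"
  assumes f: "\<And>x e. f x e < m" and h: "\<And>x e. \<bar>h x e\<bar> \<le> int M"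
    and r: "loaded r" "r 9 = int p" and p: "p + n * d \<le> 2 * n * d"
    and vec: "\<And>i c mem a. i < n \<Longrightarrow> P i c mem a \<Longrightarrow> holds_vector mem (p + i * d) (v i)"
    and act: "\<And>i c r mem. i < n \<Longrightarrow> c < s ^ g \<Longrightarrow> P i c mem (r 21) \<Longrightarrow>
       r 12 = int (index b s m f (v i) c g) \<Longrightarrow> r 13 = weight b s h (v i) c g \<Longrightarrow>
       runs w act A r mem (\<lambda>r' mem'. P i (Suc c) mem' (r' 21))"
    and writes: "writes act \<subseteq> {18, 19, 21}"
    and wrap: "\<And>i mem a. i < n \<Longrightarrow> P i (s ^ g) mem a \<Longrightarrow> P (Suc i) 0 mem a"
    and init: "P 0 0 mem (r 21)"
  shows "runs w (for_all_terms b s f h act) (n * (terms_time A + 4) + 2) r mem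
    (\<lambda>r' mem'. P n 0 mem' (r' 21) \<and> loaded r' \<and> r' 9 = int (p + n * d))"
proof -
  let ?inner = "decode b s f h ;; act ;; Arith ADD 11 11 2"
  let ?outer = "Const 11 0 ;; While LESS 11 7 ?inner ;; Arith ADD 9 9 1 ;; Arith ADD 10 10 2"
  have writes': "x \<notin> writes ?outer" "x \<notin> writes ?inner" if "x \<le> 7 \<or> x = 22" for x
    using that writes by (auto simp: writes_decode)
  have writes_inner: "x \<notin> writes ?inner" if "x = 9 \<or> x = 10" for x
    using that writes by (auto simp: writes_decode)
  have inner: "runs w (While LESS 11 7 ?inner) (terms_time A) r0 mem0
      (\<lambda>r' mem'. r' 11 = int (s ^ g) \<and> P i (s ^ g) mem' (r' 21))"
    if i: "i < n" and r0: "loaded r0" "r0 9 = int (p + i * d)" "r0 11 = 0" "P i 0 mem0 (r0 21)" for i r0 mem0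
  proof -
    let ?I = "\<lambda>c r' mem'. r' 11 = int c \<and> P i c mem' (r' 21)"
    have "runs w (While LESS 11 7 ?inner) (s ^ g * ((decode_time + A + 1) + 1) + 1) r0 mem0 (?I (s ^ g))"
    proof (rule runs_While[where I = ?I])
      fix c r' mem'
      assume c: "c < s ^ g" and I: "?I c r' mem'" and fr: "\<And>x. x \<notin> writes ?inner \<Longrightarrow> r' x = r0 x"
      have l: "loaded r'" using loaded_cong[OF r0(1)] fr writes'(2) by blast
      have 9: "r' 9 = int (p + i * d)" using fr writes_inner r0(2) by metis
      have sc: "small w (int c)" by (rule small_le[OF less_imp_le[OF c] terms_less])
      have v: "holds_vector mem' (p + i * d) (v i)" using vec i I by blast
      have "runs w ?inner (decode_time + A + 1) r' mem' (?I (Suc c))"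
      proof (rule runs_step[OF runs_decode[where c = c and v = "v i" and p = "p + i * d", OF f h l 9]], goal_cases)
        case (5 r1 m1)
        have dec: "m1 = mem'" "r1 12 = int (index b s m f (v i) c g)" "r1 13 = weight b s h (v i) c g"
          "r1 21 = r' 21" "r1 11 = int c" "r1 2 = 1"
          using 5 I l by (auto simp: writes_decode loaded_def)
        have "runs w act A r1 m1 (\<lambda>r' mem'. P i (Suc c) mem' (r' 21))"
          using act[OF i c, of m1 r1] dec I by simp
        then show ?case
        proof (rule runs_step, goal_cases)
          case (2 r2 m2)
          moreover have "11 \<notin> writes act" "2 \<notin> writes act" using writes by auto
          ultimately have "r2 11 = int c" "r2 2 = 1" using dec by auto
          with 2 show ?case using sc small_consts by (intro straight_line) auto
        qed simp
      qed (use I c v in auto)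
      then show "small w (r' 11) \<and> small w (r' 7) \<and> compare_val LESS (r' 11) (r' 7) \<and>
          runs w ?inner (decode_time + A + 1) r' mem' (?I (Suc c))"
        using I l sc small_consts c unfolding loaded_def
        by (simp only: compare_val.simps of_nat_less_iff simp_thms)
    next
      fix r' mem'
      assume I: "?I (s ^ g) r' mem'" and fr: "\<And>x. x \<notin> writes ?inner \<Longrightarrow> r' x = r0 x"
      have "loaded r'" using loaded_cong[OF r0(1)] fr writes'(2) by blast
      then show "small w (r' 11) \<and> small w (r' 7) \<and> \<not> compare_val LESS (r' 11) (r' 7)"
        using I small_consts unfolding loaded_def by auto
    qed (use r0 in auto)
    then show ?thesis by (simp add: terms_time_def)
  qed
  let ?J = "\<lambda>i r' mem'. r' 10 = int i \<and> r' 9 = int (p + i * d) \<and> P i 0 mem' (r' 21)"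
  have outer: "runs w (While LESS 10 0 ?outer) (n * ((terms_time A + 3) + 1) + 1) r0 mem (?J n)"
    if r0: "?J 0 r0 mem" "loaded r0" for r0
  proof (rule runs_While[where I = ?J])
    fix i r' mem'
    assume i: "i < n" and J: "?J i r' mem'" and fr: "\<And>x. x \<notin> writes ?outer \<Longrightarrow> r' x = r0 x"
    have l: "loaded r'" using loaded_cong[OF r0(2)] fr writes'(1) by blast
    have si: "small w (int i)" using i by (intro small_le[OF _ size_less(1)]) simp
    have "i * d \<le> n * d" using i by (intro mult_le_mono1) simp
    then have sp: "small w (int (p + i * d))" using p by (intro small_le[OF _ address_less]) linarith
    have "runs w ?outer (terms_time A + 3) r' mem' (?J (Suc i))"
    proof (rule runs_Seq_Const, goal_cases)
      case 3
      show ?case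
      proof (rule runs_step[OF inner[OF i]], goal_cases)
        case (6 r1 m1)
        have fr1: "r1 x = r' x" if "x \<le> 7 \<or> x = 22 \<or> x = 9 \<or> x = 10" for x
        proof -
          have "x \<noteq> 11" "x \<notin> writes ?inner" using that writes' writes_inner by auto
          then show ?thesis using 6 by simp
        qed
        have "loaded r1" using loaded_cong[OF l] fr1 by blast
        then have "r1 9 = int (p + i * d)" "r1 10 = int i" "r1 1 = int d" "r1 2 = 1"
          using J fr1[of 9] fr1[of 10] unfolding loaded_def by auto
        moreover have "P (Suc i) 0 m1 (r1 21)" using 6 wrap i by blast
        ultimately show ?case using si sp small_consts
          by (intro straight_line) (auto simp: algebra_simps)
      qed (use J l in \<open>auto simp: loaded_def\<close>)
    qed (use small_consts in auto)
    then show "small w (r' 10) \<and> small w (r' 0) \<and> compare_val LESS (r' 10) (r' 0) \<and>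
        runs w ?outer (terms_time A + 3) r' mem' (?J (Suc i))"
      using J l si small_consts i unfolding loaded_def
      by (simp only: compare_val.simps of_nat_less_iff simp_thms)
  next
    fix r' mem'
    assume J: "?J n r' mem'" and fr: "\<And>x. x \<notin> writes ?outer \<Longrightarrow> r' x = r0 x"
    have "loaded r'" using loaded_cong[OF r0(2)] fr writes'(1) by blast
    then show "small w (r' 10) \<and> small w (r' 0) \<and> \<not> compare_val LESS (r' 10) (r' 0)"
      using J small_consts unfolding loaded_def by auto
  qed (use r0 in auto)
  show ?thesis
    unfolding for_all_terms_def
  proof (rule runs_Seq_Const, goal_cases)
    case 3
    have r0: "?J 0 (r(10 := 0)) mem" "loaded (r(10 := 0))"
      using r init by (auto simp: loaded_def)
    show ?case
    proof (rule runs_mono[OF runs_frame[OF outer[OF r0]]], goal_cases)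
      case (2 r' m')
      then have "r' x = r x" if "x \<le> 7 \<or> x = 22" for x
        using writes'(1)[OF that] that by simp
      then have "loaded r'" using loaded_cong[OF r(1)] by blast
      with 2 show ?case by blast
    qed simp
  qed (use small_consts in auto)
qed

end

section \<open>The two passes over the input\<close>

lemma nth_concat_uniform:
  assumes "\<And>u. u \<in> set us \<Longrightarrow> length u = d" "i < length us" "q < d"
  shows "concat us ! (i * d + q) = us ! i ! q"
  using assms
proof (induction us arbitrary: i)
  case (Cons u us)
  have len: "length u = d" using Cons.prems(1) by simp
  show ?case
  proof (cases i)
    case 0
    then show ?thesis using Cons.prems(3) len by (simp add: nth_append)
  next
    case (Suc i')
    have "concat us ! (i' * d + q) = us ! i' ! q" using Cons.prems Suc by (intro Cons.IH) auto
    then show ?thesis using Suc len by (simp add: nth_append add.assoc)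
  qed
qed simp

lemma length_concat_uniform:
  assumes "\<And>u. u \<in> set us \<Longrightarrow> length u = d"
  shows "length (concat us) = length us * d"
  using assms by (induction us) auto

lemma bucket_Suc:
  "bucket b s m f h g v (Suc c) q =
     bucket b s m f h g v c q + (if index b s m f v c g = q then weight b s h v c g else 0)"
  by (simp add: bucket_def)

lemma abs_sum_le_card:
  fixes F :: "nat \<Rightarrow> int"
  assumes "\<And>i. i < k \<Longrightarrow> \<bar>F i\<bar> \<le> B"
  shows "\<bar>\<Sum>i<k. F i\<bar> \<le> int k * B"
proof -
  have "\<bar>\<Sum>i<k. F i\<bar> \<le> (\<Sum>i<k. B)"
    by (intro order_trans[OF sum_abs] sum_mono) (use assms in auto)
  then show ?thesis by simp
qed

context word_bound
begin

lemma small_bucket_address: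
  assumes "i < m ^ g"
  shows "small w (int i)" "small w (-1 - int i)"
proof -
  have "m ^ g \<le> m ^ g * m" using pos by simp
  then have "Suc i < 2 ^ w" using assms index_bound by linarith
  then have "int (Suc i) < int (2 ^ w)" by (rule of_nat_less_iff[THEN iffD2])
  then have "1 + int i < 2 ^ w" by simp
  then show "small w (int i)" "small w (-1 - int i)" unfolding small_def by linarith+
qed

lemma runs_add_to_bucket:
  assumes "r 12 = int i" "i < m ^ g" "small w (mem (-1 - int i))" "small w (r 13)"
    "small w (mem (-1 - int i) + r 13)"
    and Q: "\<And>r'. r' 21 = r 21 \<Longrightarrow> Q r' (mem(-1 - int i := mem (-1 - int i) + r 13))"
  shows "runs w add_to_bucket 5 r mem Q"
  unfolding add_to_bucket_def
  using assms(1,3-5) small_bucket_address[OF assms(2)] small_consts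
  by (intro straight_line) (auto intro!: Q)

lemma runs_add_bucket_to_total:
  assumes "r 12 = int i" "i < m ^ g" "small w (mem (-1 - int i))" "small w (r 13)"
    "small w (mem (-1 - int i) * r 13)" "small w (r 21)"
    and Q: "\<And>r'. r' 21 = r 21 + mem (-1 - int i) * r 13 \<Longrightarrow> Q r' mem"
  shows "runs w add_bucket_to_total 5 r mem Q"
  unfolding add_bucket_to_total_def
  using assms(1,3-6) small_bucket_address[OF assms(2)] small_consts
  by (intro straight_line) (auto intro!: Q)

lemma runs_prepare:
  assumes "g = d div b + 1" "r 0 = int n" "r 1 = int d" "\<And>x. x \<ge> 2 \<Longrightarrow> r x = 0"
  shows "runs w (prepare b s m) (3 * g + 9) r mem
    (\<lambda>r' mem'. mem' = mem \<and> loaded r' \<and> r' 9 = 0 \<and> r' 21 = 0)"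
proof -
  let ?body = "Arith MUL 7 7 4 ;; Arith ADD 8 8 2"
  let ?I = "\<lambda>j r' mem'. mem' = mem \<and> r' 8 = int j \<and> r' 7 = int (s ^ j)"
  have sp: "small w (int (s ^ j))" "small w (int j)" if "j \<le> g" for j
    using small_le[OF power_increasing[OF that, of s] terms_less] small_le[OF that size_less(2)] pos
    by (simp_all add: Suc_le_eq)
  have loop: "runs w (While LESS 8 6 ?body) (g * (2 + 1) + 1) r0 mem (?I g)"
    if r0: "?I 0 r0 mem" "r0 2 = 1" "r0 4 = int s" "r0 6 = int g" for r0
  proof (rule runs_While[where I = ?I])
    fix j r' mem'
    assume j: "j < g" and I: "?I j r' mem'" and fr: "\<And>x. x \<notin> writes ?body \<Longrightarrow> r' x = r0 x"
    have r': "r' 2 = 1" "r' 4 = int s" "r' 6 = int g" using fr r0 by auto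
    note sj = sp[of j, simplified] small_consts
    have "runs w ?body 2 r' mem' (?I (Suc j))"
      using I r' sj j by (intro straight_line) auto
    then show "small w (r' 8) \<and> small w (r' 6) \<and> compare_val LESS (r' 8) (r' 6) \<and>
        runs w ?body 2 r' mem' (?I (Suc j))"
      using I r' sj j by auto
  next
    fix r' mem'
    assume I: "?I g r' mem'" and fr: "\<And>x. x \<notin> writes ?body \<Longrightarrow> r' x = r0 x"
    have "r' 6 = int g" using fr r0 by auto
    then show "small w (r' 8) \<and> small w (r' 6) \<and> \<not> compare_val LESS (r' 8) (r' 6)"
      using I small_consts by auto
  qed (use r0 in auto)
  have g: "int d div int b + 1 = int g" using assms(1) by (simp add: zdiv_int)
  have "small w (int (d div b))" using assms(1) by (intro small_le[OF _ size_less(2)]) simp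
  then have sdiv: "small w (int d div int b)" by (simp add: zdiv_int)
  show ?thesis
    unfolding prepare_def
  proof (intro runs_Seq_Const runs_Seq_Arith, goal_cases)
    case 19
    show ?case
      by (rule runs_mono[OF runs_frame[OF loop]])
        (use assms(2-) g in \<open>auto simp: loaded_def\<close>)
  qed (use assms small_consts sdiv in auto)
qed

definition program_time :: nat where
  "program_time = (3 * g + 9) + 2 * (n * (terms_time 5 + 4) + 2) + 1"

lemma runs_count_program:
  assumes f: "\<And>x e. f x e < m" "\<And>y e. f' y e < m"
    and h: "\<And>x e. \<bar>h x e\<bar> \<le> int M" "\<And>y e. \<bar>h' y e\<bar> \<le> int M"
    and tab: "\<And>x y. x < 2 ^ b \<Longrightarrow> y < 2 ^ b \<Longrightarrow>
      disj b x y = (\<Sum>e<s. \<Sum>e'<s. if f x e = f' y e' then h x e * h' y e' else 0)"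
    and g: "g = d div b + 1"
    and us: "zero_one_vectors n d us" and vs: "zero_one_vectors n d vs"
  shows "runs w (count_program b s m f h f' h') program_time (fst (OV_input n d us vs)) (snd (OV_input n d us vs))
    (\<lambda>r' mem'. r' 0 = int (count_OV n d us vs))"
proof -
  define r where "r = fst (OV_input n d us vs)"
  define mem where "mem = snd (OV_input n d us vs)"
  define u where "u i = coords d (us ! i)" for i
  define v where "v i = coords d (vs ! i)" for i
  define G where "G q = (\<Sum>i<n. bucket b s m f h g (u i) (s ^ g) q)" for q
  define S where "S = s ^ g"
  have lens: "length us = n" "length vs = n" "\<And>x. x \<in> set us \<Longrightarrow> length x = d" "\<And>x. x \<in> set vs \<Longrightarrow> length x = d"
    using us vs by (auto simp: zero_one_vectors_def)
  have lenc: "length (concat us) = n * d" "length (concat vs) = n * d"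
    using length_concat_uniform lens by metis+
  have bits01: "length (us ! i) = d" "set (us ! i) \<subseteq> {0, 1}" "length (vs ! i) = d" "set (vs ! i) \<subseteq> {0, 1}"
    if "i < n" for i
    using us vs that by (auto simp: zero_one_vectors_def)
  have coord: "int (u i q) = us ! i ! q" "int (v i q) = vs ! i ! q" if "i < n" "q < d" for i q
    using subsetD[OF bits01(2)[OF that(1)] nth_mem[of q]] subsetD[OF bits01(4)[OF that(1)] nth_mem[of q]]
      bits01[OF that(1)] that(2) by (auto simp: u_def v_def coords_def)
  have pos_lt: "i * d + q < n * d" if "i < n" "q < d" for i q
  proof -
    have "i * d + q < Suc i * d" using that by simp
    also have "\<dots> \<le> n * d" using that by (intro mult_le_mono1) simp
    finally show ?thesis .
  qed
  have mem_u: "mem (int (0 + i * d + q)) = int (u i q)" if "i < n" "q < d" for i q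
    using nth_concat_uniform[of us d i q] lens lenc that pos_lt[OF that] coord(1)[OF that]
    by (simp add: mem_def OV_input_def nth_append nat_add_distrib nat_mult_distrib del: of_nat_add of_nat_mult)
  have mem_v: "mem (int (n * d + i * d + q)) = int (v i q)" if "i < n" "q < d" for i q
    using nth_concat_uniform[of vs d i q] lens lenc that pos_lt[OF that] coord(2)[OF that]
    by (simp add: mem_def OV_input_def nth_append add.assoc del: of_nat_add of_nat_mult)
  have u2: "u i q < 2" "v i q < 2" if "i < n" for i q
    using coords_less bits01[OF that] unfolding u_def v_def by metis+
  have u0: "u i q = 0" "v i q = 0" if "q \<ge> d" for i q
    using that by (auto simp: u_def v_def coords_def)
  have id_le: "i * d \<le> n * d" if "i < n" for i using that by (intro mult_le_mono1) simp
  have hold_u: "holds_vector mem' (0 + i * d) (u i)"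
    if "i < n" "\<And>z. z \<ge> 0 \<Longrightarrow> mem' z = mem z" for i mem'
    using mem_u[OF that(1)] u2(1)[OF that(1)] u0(1)[of _ i] id_le[OF that(1)] that(2)
    unfolding holds_vector_def by (auto simp: algebra_simps)
  have hold_v: "holds_vector mem' (n * d + i * d) (v i)"
    if "i < n" "\<And>z. z \<ge> 0 \<Longrightarrow> mem' z = mem z" for i mem'
    using mem_v[OF that(1)] u2(2)[OF that(1)] u0(2)[of _ i] id_le[OF that(1)] that(2)
    unfolding holds_vector_def by (auto simp: algebra_simps)
  have idx: "index b s m f (u i) c g < m ^ g" "index b s m f' (v i) c g < m ^ g" for i c
    using f by (auto intro!: index_less)
  have wt: "\<bar>weight b s h (u i) c g\<bar> \<le> int (M ^ g)" "\<bar>weight b s h' (v i) c g\<bar> \<le> int (M ^ g)" for i c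
    using h by (auto intro!: abs_weight_le simp del: of_nat_power)
  have swt: "small w (weight b s h (u i) c g)" "small w (weight b s h' (v i) c g)" for i c
    using wt[of i c] by (auto intro!: small_weight_bound[of _ 1 g])
  have nS: "n * S \<le> (n * s ^ g + 1)\<^sup>2" "n * S * (n * S) \<le> (n * s ^ g + 1)\<^sup>2"
    by (auto simp: S_def power2_eq_square)
  have pre: "i * S + c \<le> n * S" if "i < n" "c \<le> S" for i c
  proof -
    have "i * S + c \<le> Suc i * S" using that by simp
    also have "\<dots> \<le> n * S" using that by (intro mult_le_mono1) simp
    finally show ?thesis .
  qed
  \<comment> \<open>Content of bucket \<open>q\<close> after \<open>i\<close> complete vectors and
    \<open>c\<close> choices of vector \<open>i\<close>; \<open>B2\<close> below is the analogous
    running total.\<close>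
  define B1 where "B1 i c q = (\<Sum>i'<i. bucket b s m f h g (u i') S q) + bucket b s m f h g (u i) c q" for i c q
  have abs_sum_bucket: "\<bar>\<Sum>i'<k. bucket b s m f h g (u i') S q\<bar> \<le> int (k * S) * int (M ^ g)" for k q
    using abs_sum_le_card[of k "\<lambda>i'. bucket b s m f h g (u i') S q" "int (S * M ^ g)"]
      abs_bucket_le[where h = h and M = M, OF h(1)] by (simp add: mult.assoc)
  \<comment> \<open>Weights are signed, so partial sums are not controlled by the final value; they
    are bounded by the number of summands so far.\<close>
  have sB1: "small w (B1 i c q)" if "i < n" "c \<le> S" for i c q
  proof (rule small_weight_bound[of _ "n * S" g])
    have "\<bar>B1 i c q\<bar> \<le> int (i * S) * int (M ^ g) + int (c * M ^ g)"
      unfolding B1_def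
      by (intro order_trans[OF abs_triangle_ineq] add_mono abs_sum_bucket abs_bucket_le h)
    also have "\<dots> = int (i * S + c) * int (M ^ g)" by (simp add: algebra_simps)
    also have "\<dots> \<le> int (n * S) * int (M ^ g)"
      by (intro mult_right_mono of_nat_mono pre that) simp
    finally show "\<bar>B1 i c q\<bar> \<le> int (n * S) * int (M ^ g)" .
  qed (use nS in auto)
  \<comment> \<open>The nonnegative cells stay untouched, so the second pass still finds its
    vectors.\<close>
  let ?P1 = "\<lambda>i c mem' a. (\<forall>z\<ge>0. mem' z = mem z) \<and> a = 0 \<and> (\<forall>q. mem' (-1 - int q) = B1 i c q)"
  have phase1: "runs w (for_all_terms b s f h add_to_bucket) (n * (terms_time 5 + 4) + 2) r1 mem
     (\<lambda>r' mem'. ?P1 n 0 mem' (r' 21) \<and> loaded r' \<and> r' 9 = int (0 + n * d))"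
    if "loaded r1" "r1 9 = 0" "r1 21 = 0" for r1
  proof (rule runs_for_all_terms[where P = ?P1 and v = u, OF f(1) h(1)], goal_cases)
    case (5 i c r mem')
    let ?i = "index b s m f (u i) c g"
    have "small w (B1 i c ?i)" "small w (B1 i (Suc c) ?i)" using 5 by (auto intro!: sB1 simp: S_def)
    moreover have "B1 i (Suc c) ?i = B1 i c ?i + weight b s h (u i) c g" by (simp add: B1_def bucket_Suc)
    ultimately show ?case
      using 5 swt(1)[of i c] by (intro runs_add_to_bucket[where r = r and i = ?i, OF 5(4) idx(1)]) (auto simp: B1_def bucket_Suc add.assoc)
  next
    case 8
    have "mem (-1 - int q) = 0" for q by (simp add: mem_def OV_input_def)
    then show ?case using that by (simp add: B1_def bucket_def)
  qed (use that hold_u in \<open>auto simp: add_to_bucket_def B1_def S_def bucket_def\<close>)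
  define T where "T j c = G (index b s m f' (v j) c g) * weight b s h' (v j) c g" for j c
  define B2 where "B2 j c = (\<Sum>j'<j. \<Sum>c'<S. T j' c') + (\<Sum>c'<c. T j c')" for j c
  have absG: "\<bar>G q\<bar> \<le> int (n * S) * int (M ^ g)" for q
    using abs_sum_bucket[of q n] unfolding G_def S_def .
  have absT: "\<bar>T j c\<bar> \<le> int (n * S) * int (M ^ (2 * g))" for j c
  proof -
    have "\<bar>T j c\<bar> \<le> (int (n * S) * int (M ^ g)) * int (M ^ g)"
      unfolding T_def abs_mult by (intro mult_mono absG wt) auto
    then show ?thesis by (simp add: mult_2 power_add mult.assoc)
  qed
  have sG: "small w (G q)" for q
    using absG by (rule small_weight_bound) (use nS in auto)
  have sT: "small w (T j c)" for j c
    using absT by (rule small_weight_bound) (use nS in auto)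
  have sB2: "small w (B2 j c)" if "j < n" "c \<le> S" for j c
  proof (rule small_weight_bound[of _ "n * S * (n * S)" "2 * g"])
    let ?K = "int (n * S) * int (M ^ (2 * g))"
    have "\<bar>B2 j c\<bar> \<le> int j * (int S * ?K) + int c * ?K"
      unfolding B2_def
      by (intro order_trans[OF abs_triangle_ineq] add_mono abs_sum_le_card absT)
    also have "\<dots> = int (j * S + c) * ?K" by (simp add: algebra_simps)
    also have "\<dots> \<le> int (n * S) * ?K"
      by (intro mult_right_mono of_nat_mono pre that) simp
    finally show "\<bar>B2 j c\<bar> \<le> int (n * S * (n * S)) * int (M ^ (2 * g))" by (simp add: mult.assoc)
  qed (use nS in auto)
  let ?mem1 = "\<lambda>mem1. (\<forall>z\<ge>0. mem1 z = mem z) \<and> (\<forall>q. mem1 (-1 - int q) = G q)"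
  let ?P2 = "\<lambda>j c mem1 a. ?mem1 mem1 \<and> a = B2 j c"
  have phase2: "runs w (for_all_terms b s f' h' add_bucket_to_total) (n * (terms_time 5 + 4) + 2) r1 mem1
     (\<lambda>r' mem'. ?P2 n 0 mem' (r' 21) \<and> loaded r' \<and> r' 9 = int (n * d + n * d))"
    if "?mem1 mem1" "loaded r1" "r1 9 = int (n * d)" "r1 21 = 0" for r1 mem1
  proof (rule runs_for_all_terms[where P = ?P2 and v = v, OF f(2) h(2)], goal_cases)
    case (5 j c r mem')
    have "small w (B2 j c)" using 5 by (auto intro!: sB2 simp: S_def)
    then show ?case
      using 5 swt(2)[of j c] sG sT[of j c]
      by (intro runs_add_bucket_to_total[where r = r and i = "index b s m f' (v j) c g", OF 5(4) idx(2)]) (auto simp: B2_def T_def add.assoc)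
  qed (use that hold_v in \<open>auto simp: add_bucket_to_total_def B2_def S_def\<close>)
  have result: "B2 n 0 = int (count_OV n d us vs)"
  proof -
    have "d \<le> g * b" by (rule d_le)
    then show ?thesis
      using count_OV_eq_buckets[where f = f and f' = f', OF us vs f tab]
      by (simp add: B2_def T_def G_def u_def v_def S_def)
  qed
  have "small w (B2 n 0)"
  proof (rule small_weight_bound[of _ "n * S * (n * S)" "2 * g"])
    have "\<bar>B2 n 0\<bar> \<le> int n * (int S * (int (n * S) * int (M ^ (2 * g))))"
      unfolding B2_def by (simp del: of_nat_mult of_nat_power) (intro abs_sum_le_card absT)
    then show "\<bar>B2 n 0\<bar> \<le> int (n * S * (n * S)) * int (M ^ (2 * g))" by (simp add: mult.assoc)
  qed (use nS in auto)
  have "runs w (count_program b s m f h f' h') program_time r mem (\<lambda>r' mem'. r' 0 = int (count_OV n d us vs))"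
    unfolding count_program_def program_time_def
  proof (rule runs_Seq[OF runs_prepare[OF g]], goal_cases)
    case (5 r1 m1)
    then have m1: "m1 = mem" by simp
    show ?case
      unfolding m1
    proof (rule runs_Seq[OF phase1], goal_cases)
      case (5 r2 m2)
      have "B1 n 0 q = G q" for q by (simp add: B1_def G_def S_def bucket_def)
      then have *: "?mem1 m2" "loaded r2" "r2 9 = int (n * d)" "r2 21 = 0" using 5 by auto
      show ?case
      proof (rule runs_Seq[OF phase2[OF *]], goal_cases)
        case (2 r3 m3)
        then show ?case using \<open>small w (B2 n 0)\<close> result small_consts
          by (intro straight_line) (auto simp: loaded_def)
      qed simp
    qed (use 5 in auto)
  qed (auto simp: r_def OV_input_def)
  then show ?thesis unfolding r_def mem_def .
qed

end

section \<open>Running time\<close>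

text \<open>With \<open>E = 2 ^ floorlog 2 n\<close> and \<open>Y = 2 ^ (L * (g + 1))\<close> the
  word size gives \<open>2 * E\<^sup>2 * Y ^ 5\<close>. \<open>Y\<close> dominates
  \<open>s ^ g\<close>, \<open>m ^ (g + 1)\<close>, \<open>M ^ (g + 1)\<close> and
  \<open>g + 1\<close>. The largest total needs \<open>E\<^sup>2 * Y ^ 4\<close>, the factor 2
  covers the addresses via \<open>2 * n + 1 \<le> 2 * E\<^sup>2\<close>, and the fifth
  \<open>Y\<close> makes the bounds strict.\<close>

lemma word_bound_exists:
  fixes b s m M n d :: nat
  defines "L \<equiv> b + s + m + M + 2 ^ b * s"
  defines "g \<equiv> d div b + 1"
  assumes pos: "b > 0" "s > 0" "m > 0" "M > 0"
  shows "word_bound b s m g n d (2 * floorlog 2 n + 5 * (L * (g + 1)) + 1) M"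
proof -
  define E :: nat where "E = 2 ^ floorlog 2 n"
  define Y :: nat where "Y = 2 ^ (L * (g + 1))"
  let ?w = "2 * floorlog 2 n + 5 * (L * (g + 1)) + 1"
  have X: "2 ^ ?w = 2 * E\<^sup>2 * Y ^ 5"
    unfolding E_def Y_def by (simp only: power_add power_mult[symmetric] mult.commute mult.left_commute power_one_right)
  have nE: "n < E"
    using floorlog_bounds[of n 2] by (cases "n = 0") (auto simp: E_def)
  have L_le: "L \<le> L * (g + 1)" by simp
  have pow: "k \<le> 2 ^ L" if "k \<le> L" for k
  proof -
    have "k < 2 ^ k" by (rule less_exp)
    also have "\<dots> \<le> (2::nat) ^ L" using that by (intro power_increasing) auto
    finally show ?thesis by simp
  qed
  have LY: "2 ^ L \<le> Y" unfolding Y_def by (intro power_increasing L_le) simp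
  have "b \<le> L" "s \<le> L" "m \<le> L" "M \<le> L" "2 ^ b * s \<le> L" by (auto simp: L_def)
  note small = this[THEN pow]
  have "Y \<ge> 2"
  proof -
    have "2 ^ 1 \<le> (2::nat) ^ L" using pos by (intro power_increasing) (auto simp: L_def)
    with LY show ?thesis by simp
  qed
  have gY: "g + 1 \<le> Y"
  proof -
    have "g + 1 < 2 ^ (g + 1)" by (rule less_exp)
    also have "\<dots> \<le> Y" unfolding Y_def using mult_le_mono1[of 1 L "g + 1"] pos
      by (intro power_increasing) (simp_all add: L_def)
    finally show ?thesis by simp
  qed
  have powY: "k ^ (g + 1) \<le> Y" if "k \<le> 2 ^ L" for k
    using power_mono[OF that, of "g + 1"] by (simp only: Y_def power_mult)
  have sY: "s ^ g \<le> Y"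
    using power_increasing[of g "g + 1" s] powY[OF small(2)] pos by linarith
  have MY: "M ^ (2 * g + 1) \<le> Y\<^sup>2"
  proof -
    have "M ^ (2 * g + 1) \<le> M ^ (2 * (g + 1))" using pos by (intro power_increasing) auto
    also have "\<dots> = (M ^ (g + 1))\<^sup>2" by (simp only: power_mult[symmetric] mult.commute)
    also have "\<dots> \<le> Y\<^sup>2" using powY[OF small(4)] by (intro power_mono) auto
    finally show ?thesis .
  qed
  have less: "k < 2 ^ ?w" if "k \<le> 2 * E\<^sup>2 * Y ^ 4" for k
  proof -
    have "Y ^ 4 * 1 < Y ^ 4 * Y" using \<open>Y \<ge> 2\<close> by (intro mult_strict_left_mono) auto
    then have "2 * E\<^sup>2 * Y ^ 4 < 2 * E\<^sup>2 * Y ^ 5"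
      using nE by (intro mult_strict_left_mono) (auto simp: eval_nat_numeral mult_ac)
    with that show ?thesis unfolding X by linarith
  qed
  have E1: "1 \<le> 2 * E\<^sup>2" "2 * E \<le> 2 * E\<^sup>2" "E \<le> 2 * E\<^sup>2" "E\<^sup>2 \<le> 2 * E\<^sup>2" using nE by (auto simp: power2_eq_square)
  have Y4: "Y \<le> Y ^ 4" "Y\<^sup>2 \<le> Y ^ 4" "1 \<le> Y ^ 4"
    using power_increasing[of 1 4 Y] power_increasing[of 2 4 Y] power_increasing[of 0 4 Y] \<open>Y \<ge> 2\<close> by auto
  have lessY: "k < 2 ^ ?w" if "k \<le> Y" for k
    using mult_mono[OF E1(1) Y4(1)] that by (intro less) simp
  have cY: "(g + 1) * b \<le> Y\<^sup>2"
    unfolding power2_eq_square using gY small(1) LY by (intro mult_mono) auto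
  have d_le: "d \<le> g * b"
    using div_mult_mod_eq[of d b] mod_less_divisor[OF pos(1), of d]
    unfolding g_def add_mult_distrib by linarith
  show ?thesis
  proof
    show "2 * n * d + d < 2 ^ ?w"
    proof (rule less)
      have "2 * n * d + d = (2 * n + 1) * d" by simp
      also have "\<dots> \<le> (2 * E\<^sup>2) * Y ^ 4"
      proof (rule mult_mono)
        show "2 * n + 1 \<le> 2 * E\<^sup>2" using nE E1(2) by linarith
        have "g * b \<le> (g + 1) * b" by simp
        then show "d \<le> Y ^ 4" using d_le cY Y4(2) by linarith
      qed auto
      finally show "2 * n * d + d \<le> 2 * E\<^sup>2 * Y ^ 4" .
    qed
    show "(g + 1) * b < 2 ^ ?w"
      using mult_mono[OF E1(1) order_trans[OF cY Y4(2)]] by (intro less) simp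
    show "(n * s ^ g + 1)\<^sup>2 * M ^ (2 * g + 1) < 2 ^ ?w"
    proof (rule less)
      have "n * s ^ g + 1 \<le> (n + 1) * s ^ g" using pos by (simp add: Suc_le_eq)
      also have "\<dots> \<le> E * Y" using nE sY by (intro mult_mono) auto
      finally have "(n * s ^ g + 1)\<^sup>2 * M ^ (2 * g + 1) \<le> (E * Y)\<^sup>2 * Y\<^sup>2"
        using MY by (intro mult_mono power_mono) auto
      also have "\<dots> = E\<^sup>2 * Y ^ 4" by (simp add: eval_nat_numeral)
      also have "\<dots> \<le> 2 * E\<^sup>2 * Y ^ 4" by (intro mult_right_mono E1) simp
      finally show "(n * s ^ g + 1)\<^sup>2 * M ^ (2 * g + 1) \<le> 2 * E\<^sup>2 * Y ^ 4" .
    qed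
    show "m ^ g * m < 2 ^ ?w" using powY[OF small(3)] by (intro lessY) (simp add: mult.commute)
    show "n < 2 ^ ?w" using nE mult_mono[OF E1(3) Y4(3)] by (intro less) simp
    show "2 ^ b * s < 2 ^ ?w" "s ^ g < 2 ^ ?w" "g < 2 ^ ?w"
      by (rule lessY, use small(5) LY sY gY in linarith)+
  qed (use pos d_le in auto)
qed

locale disj_tables =
  fixes b s m M :: nat and f f' :: "nat \<Rightarrow> nat \<Rightarrow> nat" and h h' :: "nat \<Rightarrow> nat \<Rightarrow> int"
  assumes pos: "b > 0" "s > 0" "m > 0" "M > 0"
    and sparse: "real s \<le> 1.26 ^ b"
    and index_entry_less: "\<And>x e. f x e < m" "\<And>y e. f' y e < m"
    and weight_entry_le: "\<And>x e. \<bar>h x e\<bar> \<le> int M" "\<And>y e. \<bar>h' y e\<bar> \<le> int M"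
    and disj_eq: "\<And>x y. x < 2 ^ b \<Longrightarrow> y < 2 ^ b \<Longrightarrow>
      disj b x y = (\<Sum>e<s. \<Sum>e'<s. if f x e = f' y e' then h x e * h' y e' else 0)"

text \<open>The weights come as functions on all numbers. Cutting them off outside the finite table
  makes a common bound \<open>M\<close> available, here from the sum of all absolute values.\<close>

lemma disj_tables_exist: "\<exists>b s m M f f' h h'. disj_tables b s m M f f' h h'"
proof -
  obtain b s where bs: "b > 0" "s > 0" "real s \<le> 1.26 ^ b"
    "sparse_fac (\<lambda>x y. if x < 2 ^ b \<and> y < 2 ^ b then disj b x y else 0) (\<lambda>x. s) (\<lambda>y. s)"
    using sparse_fac_disj_exists by blast
  show ?thesis
  proof (rule sparse_tables[OF bs(4)])
    fix m :: nat and f f' h h'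
    assume fh: "m > 0" "\<And>x e. f x e < m" "\<And>y e. f' y e < m"
      "\<And>x y. (if x < 2 ^ b \<and> y < 2 ^ b then disj b x y else 0) =
         (\<Sum>e<s. \<Sum>e'<s. if f x e = f' y e' then h x e * h' y e' else 0)"
    define cut where "cut k = (\<lambda>x e. if x < (2::nat) ^ b \<and> e < s then k x e else (0::int))" for k
    define A where "A k = (\<Sum>x<(2::nat) ^ b. \<Sum>e<s. \<bar>k x e\<bar>)" for k :: "nat \<Rightarrow> nat \<Rightarrow> int"
    define M where "M = nat (A h + A h') + 1"
    have A_nonneg: "A k \<ge> 0" for k by (auto simp: A_def intro!: sum_nonneg)
    have cut_le: "\<bar>cut k x e\<bar> \<le> A k" for k x e
    proof (cases "x < 2 ^ b \<and> e < s")
      case True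
      have "\<bar>k x e\<bar> \<le> (\<Sum>e<s. \<bar>k x e\<bar>)" using True by (intro member_le_sum) auto
      also have "\<dots> \<le> A k"
        unfolding A_def using True by (intro member_le_sum[of x _ "\<lambda>x. \<Sum>e<s. \<bar>k x e\<bar>"]) (auto intro: sum_nonneg)
      finally show ?thesis using True by (simp add: cut_def)
    qed (use A_nonneg in \<open>auto simp: cut_def\<close>)
    have "disj_tables b s m M f f' (cut h) (cut h')"
    proof
      show "\<bar>cut h x e\<bar> \<le> int M" "\<bar>cut h' x e\<bar> \<le> int M" for x e
        using cut_le[of h x e] cut_le[of h' x e] A_nonneg[of h] A_nonneg[of h'] by (auto simp: M_def)
      fix x y :: nat
      assume xy: "x < 2 ^ b" "y < 2 ^ b"
      then have "disj b x y = (\<Sum>e<s. \<Sum>e'<s. if f x e = f' y e' then h x e * h' y e' else 0)"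
        using fh(4)[of x y] by simp
      also have "\<dots> = (\<Sum>e<s. \<Sum>e'<s. if f x e = f' y e' then cut h x e * cut h' y e' else 0)"
        using xy by (intro sum.cong refl) (simp add: cut_def)
      finally show "disj b x y = \<dots>" .
    qed (use bs fh in \<open>auto simp: M_def\<close>)
    then show ?thesis by blast
  qed
qed

text \<open>The \<open>n * s ^ g\<close> choices dominate; decoding each of them afresh costs only
  the factor \<open>g + 1\<close>.\<close>

lemma (in word_bound) program_time_le:
  assumes "n \<ge> 1"
  shows "program_time \<le> (2 * decode_step_time + 50) * ((g + 1) * (n * s ^ g))"
proof -
  have 1: "1 \<le> s ^ g" "1 \<le> n * s ^ g" using pos assms by auto
  have "3 * g + 14 \<le> 14 * (g + 1) * 1" by simp
  also have "\<dots> \<le> 14 * (g + 1) * (n * s ^ g)" by (rule mult_le_mono2[OF 1(2)])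
  finally have a: "3 * g + 14 \<le> 14 * (g + 1) * (n * s ^ g)" .
  have "terms_time 5 + 4 = s ^ g * (g * (decode_step_time + 1) + 12) + 5 * 1"
    by (simp add: terms_time_def decode_time_def algebra_simps)
  also have "\<dots> \<le> s ^ g * (g * (decode_step_time + 1) + 12) + 5 * s ^ g"
    by (intro add_left_mono mult_le_mono2 1)
  also have "\<dots> = s ^ g * (g * (decode_step_time + 1) + 17)" by (simp add: algebra_simps)
  also have "\<dots> \<le> s ^ g * ((g + 1) * (decode_step_time + 18))"
    by (intro mult_le_mono2) (simp add: algebra_simps)
  finally have "n * (terms_time 5 + 4) \<le> n * (s ^ g * ((g + 1) * (decode_step_time + 18)))"
    by (rule mult_le_mono2)
  then have "2 * (n * (terms_time 5 + 4)) \<le> (2 * decode_step_time + 36) * ((g + 1) * (n * s ^ g))"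
    by (simp add: algebra_simps)
  with a have "3 * g + 14 + 2 * (n * (terms_time 5 + 4)) \<le>
      14 * (g + 1) * (n * s ^ g) + (2 * decode_step_time + 36) * ((g + 1) * (n * s ^ g))"
    by (rule add_mono)
  also have "\<dots> = (2 * decode_step_time + 50) * ((g + 1) * (n * s ^ g))" by (simp add: algebra_simps)
  finally show ?thesis by (simp add: program_time_def)
qed

theorem theorem1p2:
  shows "\<exists>(prog :: com) (T :: nat \<Rightarrow> nat \<Rightarrow> real).
           T \<in> soft_O (\<lambda>n d. real n * 1.26 ^ d) \<and> solves_count_OV_in_time prog T"
proof -
  obtain b s m M f f' h h' where "disj_tables b s m M f f' h h'"
    using disj_tables_exist by blast
  then interpret tables: disj_tables b s m M f f' h h' .
  define g where "g d = d div b + 1" for d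
  define L where "L = b + s + m + M + 2 ^ b * s"
  define w where "w n d = 2 * floorlog 2 n + 5 * (L * (g d + 1)) + 1" for n d
  define \<kappa> where "\<kappa> = 8 * b + 4 * (2 ^ b * s) + 18"
  define T where "T n d = real (word_bound.program_time b s (g d) n * (2 * w n d + 2))" for n d
  \<comment> \<open>The factors come from the steps per block, from
    \<open>g + 1 \<le> 2 * X\<close>, from the word size, and from the extra block, which costs
    \<open>1.26 ^ b\<close>.\<close>
  define C :: real where "C = real (2 * \<kappa> + 50) * 2 * (20 * real L + 8) * 1.26 ^ b"
  have wb: "word_bound b s m (g d) n d (w n d) M" for n d
    unfolding g_def w_def L_def using tables.pos by (rule word_bound_exists)
  have "solves_count_OV_in_time (count_program b s m f h f' h') T"
    unfolding solves_count_OV_in_time_def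
  proof (intro allI impI)
    fix n d us vs
    assume "zero_one_vectors n d us" "zero_one_vectors n d vs"
    then have "runs (w n d) (count_program b s m f h f' h') (word_bound.program_time b s (g d) n)
        (fst (OV_input n d us vs)) (snd (OV_input n d us vs)) (\<lambda>r' mem'. r' 0 = int (count_OV n d us vs))"
      by (intro word_bound.runs_count_program[OF wb tables.index_entry_less tables.weight_entry_le tables.disj_eq]) (auto simp: g_def)
    then obtain t r m' where "exec (count_program b s m f h f' h') (OV_input n d us vs) t (r, m')"
        "t \<le> word_bound.program_time b s (g d) n * (2 * w n d + 2)" "r 0 = int (count_OV n d us vs)"
      unfolding runs_def prod.collapse by blast
    moreover from this(2) have "real t \<le> T n d" unfolding T_def by (rule of_nat_mono)
    ultimately show "\<exists>t r m'. exec (count_program b s m f h f' h') (OV_input n d us vs) t (r, m') \<and>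
        r 0 = int (count_OV n d us vs) \<and> real t \<le> T n d"
      by blast
  qed
  moreover have "T \<in> soft_O (\<lambda>n d. real n * 1.26 ^ d)"
  proof -
    \<comment> \<open>Exponent 2: one factor for the number of blocks, one for the word
      size.\<close>
    have "\<bar>T n d\<bar> \<le> C * (1 + real d + log 2 (real n)) ^ 2 * \<bar>real n * 1.26 ^ d\<bar>" if n: "n \<ge> 1" for n d
    proof -
      define X where "X = 1 + real d + log 2 (real n)"
      have lg: "log 2 (real n) \<ge> 0" using n by simp
      have X1: "1 + real d \<le> X" "log 2 (real n) \<le> X - 1" "1 \<le> X" using lg by (auto simp: X_def)
      have "g d \<le> 1 + d" by (simp add: g_def)
      then have "g d + 1 \<le> 2 * (1 + d)" by simp
      then have "real (g d + 1) \<le> real (2 * (1 + d))" by (rule of_nat_mono)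
      then have gX: "real (g d + 1) \<le> 2 * X" using X1(1) by simp
      have "word_bound.program_time b s (g d) n \<le> (2 * \<kappa> + 50) * ((g d + 1) * (n * s ^ g d))"
        using word_bound.program_time_le[OF wb n] by (simp add: word_bound.decode_step_time_def[OF wb] \<kappa>_def)
      then have "real (word_bound.program_time b s (g d) n) \<le> real ((2 * \<kappa> + 50) * ((g d + 1) * (n * s ^ g d)))"
        by (rule of_nat_mono)
      also have "\<dots> = real (2 * \<kappa> + 50) * (real (g d + 1) * (real n * real s ^ g d))"
        by (simp only: of_nat_mult of_nat_power)
      also have "\<dots> \<le> real (2 * \<kappa> + 50) * (2 * X * (real n * (1.26 ^ b * 1.26 ^ d)))"
      proof (intro mult_left_mono mult_mono)
        show "real (g d + 1) \<le> 2 * X" by (rule gX)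
        have "real s ^ g d \<le> (1.26 ^ b) ^ g d" using tables.sparse by (intro power_mono) auto
        also have "\<dots> = 1.26 ^ (b * g d)" by (simp only: power_mult)
        \<comment> \<open>\<open>b * (d div b) \<le> d\<close>, so rounding up to whole blocks adds
          at most \<open>b\<close> to the exponent.\<close>
        also have "\<dots> \<le> 1.26 ^ (b + d)"
          by (intro power_increasing) (auto simp: g_def algebra_simps)
        also have "\<dots> = 1.26 ^ b * 1.26 ^ d" by (rule power_add)
        finally show "real s ^ g d \<le> 1.26 ^ b * 1.26 ^ d" .
      qed (use X1 in auto)
      finally have time: "real (word_bound.program_time b s (g d) n) \<le>
          real (2 * \<kappa> + 50) * (2 * X * (real n * (1.26 ^ b * 1.26 ^ d)))" .
      have "real (floorlog 2 n) \<le> 1 + log 2 (real n)"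
        using n lg by (simp add: floorlog_def)
      moreover have "real L * real (g d + 1) \<le> real L * (2 * X)"
        by (intro mult_left_mono gX) simp
      moreover have "real (2 * w n d + 2) = 4 * real (floorlog 2 n) + 10 * (real L * real (g d + 1)) + 4"
        by (simp add: w_def algebra_simps)
      ultimately have "real (2 * w n d + 2) \<le> 4 * X + 10 * (real L * (2 * X)) + 4"
        using X1(2) by linarith
      also have "\<dots> \<le> (20 * real L + 8) * X" using X1(3) by (simp add: algebra_simps)
      finally have width: "real (2 * w n d + 2) \<le> (20 * real L + 8) * X" .
      have "\<bar>T n d\<bar> = real (word_bound.program_time b s (g d) n) * real (2 * w n d + 2)"
        by (simp only: T_def of_nat_mult abs_of_nat abs_mult)
      also have "\<dots> \<le> (real (2 * \<kappa> + 50) * (2 * X * (real n * (1.26 ^ b * 1.26 ^ d)))) * ((20 * real L + 8) * X)"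
        by (intro mult_mono time width) (use X1 in auto)
      also have "\<dots> = C * X ^ 2 * \<bar>real n * 1.26 ^ d\<bar>"
        by (simp add: C_def power2_eq_square)
      finally show ?thesis by (simp add: X_def)
    qed
    then show ?thesis unfolding soft_O_def by blast
  qed
  ultimately show ?thesis by blast
qed

end
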